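(* Let $p\in(1,+\infty)$ and let $V\colon\mathbb{R}^2\to\mathbb{R}$ be a $C^1$ positive coercive function with $|\nabla V(x)|\le CV^{3/2}(x)$ for a.e. $x$ and some $C>0$. Define $I,J\colon H^1_V(\mathbb{R}^2)\to\mathbb{R}$ by \[ I(u)=\frac12\int_{\mathbb{R}^2}(|\nabla u|^2+V(x)u^2)\,dx-\frac1{p+1}\|u\|_2^2\int_{\mathbb{R}^2}V(x)|u|^{p+1}dx, \] \[ J(u)=I'(u)[u]=\int_{\mathbb{R}^2}(|\nabla u|^2+V(x)u^2)\,dx-\frac{p+3}{p+1}\|u\|_2^2\int_{\mathbb{R}^2}V(x)|u|^{p+1}dx, \] and $\mathcal N=\{u\in H^1_V(\mathbb{R}^2): u\ne0,\ J(u)=0\}$. Then $\mathcal N$ is a natural constraint for $I$, i.e. every critical point of $I$ restricted to $\mathcal N$ is a critical point of $I$ on $H^1_V(\mathbb{R}^2)$.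
   Context: $H^1_V(\mathbb{R}^2)$ is the completion of $C_0^\infty(\mathbb{R}^2)$ with respect to the norm $\|u\|_V=\left(\int_{\mathbb{R}^2}(|\nabla u|^2+V|u|^2)\,dx\right)^{1/2}$; under the stated assumptions on $V$ it embeds continuously into $L^{p+1}_V(\mathbb{R}^2)=\{u:\int V|u|^{p+1}<\infty\}$, so $I,J$ are well defined. $\|\cdot\|_2$ is the $L^2$ norm. *)

theory Defs
  imports "HOL-Analysis.Analysis"
begin

type_synonym R2 = "real^2"

fun Ck :: "nat \<Rightarrow> (R2 \<Rightarrow> real) \<Rightarrow> bool" where
  "Ck 0 f = continuous_on UNIV f"
| "Ck (Suc k) f = (\<exists>G. (\<forall>x. (f has_derivative (\<lambda>h. G x \<bullet> h)) (at x)) \<and>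
                          continuous_on UNIV f \<and> (\<forall>i. Ck k (\<lambda>x. G x $ i)))"

definition smooth_compact_support :: "(R2 \<Rightarrow> real) \<Rightarrow> bool" where
  "smooth_compact_support f \<longleftrightarrow> (\<forall>k. Ck k f) \<and> compact (closure {x. f x \<noteq> 0})"

text \<open>(u, g) represents an element of the completion H^1_V of C_0^\<infinity> under
  the norm (\<integral> |\<nabla>u|^2 + V u^2)^(1/2): u is the limit (weighted L^2) and g the limit of gradients.\<close>
definition H1V_pair :: "(R2 \<Rightarrow> real) \<Rightarrow> (R2 \<Rightarrow> real) \<Rightarrow> (R2 \<Rightarrow> R2) \<Rightarrow> bool" where
  "H1V_pair V u g \<longleftrightarrow> u \<in> borel_measurable lborel \<and> g \<in> borel_measurable lborel \<and>
     (\<exists>\<phi> G. (\<forall>n. smooth_compact_support (\<phi> n) \<and>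
                   (\<forall>x. (\<phi> n has_derivative (\<lambda>h. G n x \<bullet> h)) (at x))) \<and>
       ((\<lambda>n. \<integral>\<^sup>+ x. ennreal ((norm (G n x - g x))\<^sup>2) \<partial>lborel) \<longlonglongrightarrow> 0) \<and>
       ((\<lambda>n. \<integral>\<^sup>+ x. ennreal (V x * (\<phi> n x - u x)\<^sup>2) \<partial>lborel) \<longlonglongrightarrow> 0))"

definition H1V :: "(R2 \<Rightarrow> real) \<Rightarrow> (R2 \<Rightarrow> real) set" where
  "H1V V = {u. \<exists>g. H1V_pair V u g}"

text \<open>(weak) gradient of an element of H^1_V (unique a.e.)\<close>
definition grad :: "(R2 \<Rightarrow> real) \<Rightarrow> (R2 \<Rightarrow> real) \<Rightarrow> (R2 \<Rightarrow> R2)" where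
  "grad V u = (SOME g. H1V_pair V u g)"

definition L2sq :: "(R2 \<Rightarrow> real) \<Rightarrow> real" where
  "L2sq u = (\<integral>x. (u x)\<^sup>2 \<partial>lborel)"

definition normVsq :: "(R2 \<Rightarrow> real) \<Rightarrow> (R2 \<Rightarrow> real) \<Rightarrow> real" where
  "normVsq V u = (\<integral>x. (norm (grad V u x))\<^sup>2 + V x * (u x)\<^sup>2 \<partial>lborel)"

definition Ifun :: "(R2 \<Rightarrow> real) \<Rightarrow> real \<Rightarrow> (R2 \<Rightarrow> real) \<Rightarrow> real" where
  "Ifun V p u = 1/2 * normVsq V u
      - 1/(p+1) * L2sq u * (\<integral>x. V x * \<bar>u x\<bar> powr (p+1) \<partial>lborel)"

definition Jfun :: "(R2 \<Rightarrow> real) \<Rightarrow> real \<Rightarrow> (R2 \<Rightarrow> real) \<Rightarrow> real" where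
  "Jfun V p u = normVsq V u
      - (p+3)/(p+1) * L2sq u * (\<integral>x. V x * \<bar>u x\<bar> powr (p+1) \<partial>lborel)"

text \<open>Nehari set; u \<noteq> 0 in H^1_V means u is not a.e. zero.\<close>
definition Nehari :: "(R2 \<Rightarrow> real) \<Rightarrow> real \<Rightarrow> (R2 \<Rightarrow> real) set" where
  "Nehari V p = {u \<in> H1V V. \<not> (AE x in lborel. u x = 0) \<and> Jfun V p u = 0}"

definition has_dir_deriv :: "((R2 \<Rightarrow> real) \<Rightarrow> real) \<Rightarrow> (R2 \<Rightarrow> real) \<Rightarrow> (R2 \<Rightarrow> real) \<Rightarrow> real \<Rightarrow> bool" where
  "has_dir_deriv F u v D \<longleftrightarrow> ((\<lambda>t. F (\<lambda>x. u x + t * v x)) has_real_derivative D) (at 0)"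

end

theory Submission
  imports Defs
begin

text \<open>
  Write \<open>q = p + 1\<close>. The functionals are differentiable along lines, with derivatives
  \<open>I'(u)\<close> and \<open>J'(u)\<close> that are linear in the direction. For \<open>u\<close> in the Nehari set,
  \<open>I'(u)[u] = J(u) = 0\<close>, whereas \<open>J'(u)[u] = - q \<parallel>u\<parallel>\<^sup>2\<close> is nonzero. So every direction \<open>v\<close> splits as
  \<open>a u + w\<close> with \<open>J'(u)[w] = 0\<close>, and then \<open>I'(u)[v] = a I'(u)[u] + I'(u)[w] = 0\<close>.

  Two facts about \<open>H1V\<close> make this meaningful. The gradient is determined almost everywhere: if
  \<open>\<phi>\<^sub>n \<rightarrow> 0\<close> and \<open>\<nabla>\<phi>\<^sub>n \<rightarrow> w\<close> in \<open>L\<^sup>2\<close>, then integrating \<open>\<nabla>\<phi>\<^sub>n \<bullet> \<nabla>\<phi>\<^sub>m\<close> by parts and letting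
  first \<open>n\<close> and then \<open>m\<close> grow gives \<open>\<integral> |w|\<^sup>2 = 0\<close>, the approximants serving as test functions.
  And \<open>V |u|^q\<close> is integrable for all \<open>q \<ge> 2\<close>: Gagliardo's inequality \<open>\<integral> f\<^sup>2 \<le> (\<integral> |\<nabla>f|)\<^sup>2\<close> in the
  plane, applied to \<open>f = V^(1/2) \<phi>^k\<close>, bounds \<open>\<integral> V \<phi>^(2k)\<close> by lower powers because
  \<open>|\<nabla>V| \<le> C V^(3/2)\<close>; the bound passes to the completion by Fatou's lemma.
\<close>

section \<open>Continuously differentiable functions of compact support\<close>

text \<open>The gradient is an explicit argument, so that it can be integrated and approximated
  directly. Compact support is expressed by one radius for the function and its gradient, which
  products and powers inherit.\<close>

definition C1_compact :: "(real^2 \<Rightarrow> real) \<Rightarrow> (real^2 \<Rightarrow> real^2) \<Rightarrow> bool" where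
  "C1_compact f G \<longleftrightarrow> (\<forall>x. (f has_derivative (\<lambda>h. G x \<bullet> h)) (at x)) \<and> continuous_on UNIV G \<and>
     (\<exists>R. \<forall>x. norm x > R \<longrightarrow> f x = 0 \<and> G x = 0)"

lemma integrable_continuous_compact_support:
  fixes f :: "'a::euclidean_space \<Rightarrow> 'b::euclidean_space"
  assumes "continuous_on UNIV f" "\<And>x. norm x > R \<Longrightarrow> f x = 0"
  shows "integrable lborel f"
proof -
  have "integrable lborel (\<lambda>x. indicator (cball 0 R) x *\<^sub>R f x)"
    by (rule borel_integrable_compact) (auto intro: continuous_on_subset[OF assms(1)])
  also have "(\<lambda>x. indicator (cball 0 R) x *\<^sub>R f x) = f"
    using assms(2) by (auto simp: fun_eq_iff indicator_def not_le)
  finally show ?thesis .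
qed

lemma C1_compact_continuous: "C1_compact f G \<Longrightarrow> continuous_on UNIV f"
  unfolding C1_compact_def
  by (meson continuous_at_imp_continuous_on has_derivative_continuous)

text \<open>Difference quotients in direction \<open>axis i 1\<close> have integral zero by
  translation invariance of \<open>lborel\<close>, and they converge to the partial derivative. The
  Lipschitz bound supplies the domination.\<close>

lemma C1_compact_integral_partial_eq_0:
  assumes "C1_compact f G"
  shows "(\<integral>x. G x $ i \<partial>lborel) = 0"
proof -
  from assms obtain R where der: "\<And>x. (f has_derivative (\<lambda>h. G x \<bullet> h)) (at x)"
    and cG: "continuous_on UNIV G" and R: "\<And>x. norm x > R \<Longrightarrow> f x = 0 \<and> G x = 0"
    unfolding C1_compact_def by blast
  have cf: "continuous_on UNIV f" by (rule C1_compact_continuous[OF assms])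
  have [measurable]: "f \<in> borel_measurable borel" "G \<in> borel_measurable borel"
    using cf cG by (auto intro: borel_measurable_continuous_onI)
  have "compact (G ` cball 0 R)"
    by (rule compact_continuous_image) (auto intro: continuous_on_subset[OF cG])
  then obtain B where B: "\<And>x. x \<in> cball 0 R \<Longrightarrow> norm (G x) \<le> B" and "B > 0"
    by (metis bounded_pos compact_imp_bounded image_eqI)
  have GB: "norm (G x) \<le> B" for x
    using B[of x] R[of x] \<open>B > 0\<close> by (cases "norm x > R") auto
  have lip: "\<bar>f y - f x\<bar> \<le> B * norm (y - x)" for x y
  proof -
    have "onorm (\<lambda>h. G z \<bullet> h) \<le> B" for z
    proof (rule onorm_le)
      fix h :: "real^2"
      have "\<bar>G z \<bullet> h\<bar> \<le> norm (G z) * norm h" by (rule Cauchy_Schwarz_ineq2)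
      also have "\<dots> \<le> B * norm h" by (rule mult_right_mono[OF GB]) simp
      finally show "norm (G z \<bullet> h) \<le> B * norm h" by simp
    qed
    then show ?thesis
      using differentiable_bound[of UNIV f "\<lambda>z h. G z \<bullet> h" B y x] der by auto
  qed
  define e :: "real^2" where "e = axis i 1"
  have ne: "norm e = 1" by (simp add: e_def)
  \<comment> \<open>Step lengths at most 1 keep every difference quotient supported in the ball of
    radius \<open>R + 1\<close>, where the constant \<open>B\<close> dominates it.\<close>
  define h :: "nat \<Rightarrow> real" where "h n = inverse (real (Suc n))" for n
  have h: "h n > 0" "h n \<le> 1" for n by (auto simp: h_def field_simps)
  have h0: "h \<longlonglongrightarrow> 0" unfolding h_def by (rule LIMSEQ_inverse_real_of_nat)
  define s where "s n x = (f (h n *\<^sub>R e + x) - f x) / h n" for n x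
  have intf: "integrable lborel f"
    by (rule integrable_continuous_compact_support[OF cf]) (use R in auto)
  have s0: "integral\<^sup>L lborel (s n) = 0" for n
  proof -
    have "integrable lborel (\<lambda>x. f (h n *\<^sub>R e + x)) \<and> (\<integral>x. f (h n *\<^sub>R e + x) \<partial>lborel) = integral\<^sup>L lborel f"
      using integrable_distr_eq[of "(+) (h n *\<^sub>R e)" lborel borel f] integral_distr[of "(+) (h n *\<^sub>R e)" lborel borel f] intf
      by (simp add: lborel_distr_plus)
    then show ?thesis unfolding s_def using intf by simp
  qed
  have "(\<lambda>n. integral\<^sup>L lborel (s n)) \<longlonglongrightarrow> integral\<^sup>L lborel (\<lambda>x. G x $ i)"
  proof (rule integral_dominated_convergence[where w="\<lambda>x. indicator (cball 0 (R+1)) x *\<^sub>R B"])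
    show "integrable lborel (\<lambda>x::real^2. indicator (cball 0 (R+1)) x *\<^sub>R B)"
      by (rule borel_integrable_compact) auto
    show "AE x in lborel. norm (s n x) \<le> indicator (cball 0 (R + 1)) x *\<^sub>R B" for n
    proof (rule AE_I2)
      fix x
      show "norm (s n x) \<le> indicator (cball 0 (R + 1)) x *\<^sub>R B"
      proof (cases "norm x \<le> R + 1")
        case True
        then show ?thesis using lip[of "h n *\<^sub>R e + x" x] h[of n] ne by (simp add: s_def field_simps)
      next
        case False
        have "norm x \<le> norm (h n *\<^sub>R e + x) + norm (h n *\<^sub>R e)"
          by (metis add_diff_cancel_left' add.commute norm_triangle_ineq4)
        then have "norm (h n *\<^sub>R e + x) > R" using h[of n] ne False by auto
        then show ?thesis using False R by (auto simp: s_def)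
      qed
    qed
    show "AE x in lborel. (\<lambda>n. s n x) \<longlonglongrightarrow> G x $ i"
    proof (rule AE_I2)
      fix x
      have "((\<lambda>t. f (t *\<^sub>R e + x)) has_derivative (\<lambda>t. G x \<bullet> (t *\<^sub>R e))) (at 0)"
        by (rule has_derivative_compose[where g=f and f="\<lambda>t. t *\<^sub>R e + x" and x=0 and s=UNIV, simplified])
           (use der[of x] in \<open>auto intro!: derivative_eq_intros\<close>)
      moreover have "(\<lambda>t. G x \<bullet> (t *\<^sub>R e)) = (*) (G x $ i)"
        by (auto simp: e_def inner_axis)
      ultimately have "((\<lambda>t. f (t *\<^sub>R e + x)) has_real_derivative G x $ i) (at 0)"
        by (simp add: has_field_derivative_def)
      then have L: "((\<lambda>t. (f (t *\<^sub>R e + x) - f x) / t) \<longlongrightarrow> G x $ i) (at 0)"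
        by (simp add: DERIV_def)
      have "filterlim h (at 0) sequentially"
        using h0 h(1) by (auto simp: filterlim_at intro!: always_eventually less_imp_neq[symmetric])
      from filterlim_compose[OF L this] show "(\<lambda>n. s n x) \<longlonglongrightarrow> G x $ i"
        by (simp add: s_def)
    qed
  qed (auto simp: s_def[abs_def] intro!: borel_measurable_continuous_onI continuous_intros cG)
  then show ?thesis using s0 by (simp add: LIMSEQ_const_iff)
qed

section \<open>Fubini in the plane and Gagliardo's inequality\<close>

lemma measurable_vec2:
  "(\<lambda>(a, b). (\<chi> i. if i = 1 then a else b) :: real^2) \<in> (lborel \<Otimes>\<^sub>M lborel) \<rightarrow>\<^sub>M borel"
proof -
  have "continuous_on UNIV (\<lambda>z::real \<times> real. if i = 1 then fst z else snd z)" for i :: 2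
    by (cases "i = 1") (auto intro!: continuous_intros)
  then have "(\<lambda>z. (\<chi> i. if i = 1 then fst z else snd z) :: real^2) \<in> borel_measurable borel"
    by (intro borel_measurable_continuous_onI continuous_on_vec_lambda)
  then show ?thesis by (simp add: case_prod_beta lborel_prod)
qed

text \<open>\<open>lborel\<close> is determined by its values on boxes, and the preimage of a box
  under this map is a product of two intervals. The identification transfers Fubini's theorem to
  \<open>real^2\<close>.\<close>

lemma lborel_vec2:
  "distr (lborel \<Otimes>\<^sub>M lborel) borel (\<lambda>(a, b). (\<chi> i. if i = 1 then a else b) :: real^2) = lborel"
proof (rule lborel_eqI[symmetric])
  note m' = measurable_vec2
  fix l u :: "real^2" assume le: "\<And>b. b \<in> Basis \<Longrightarrow> l \<bullet> b \<le> u \<bullet> b"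
  have le': "l $ i \<le> u $ i" for i using le[of "axis i 1"] by (auto simp: inner_axis Basis_vec_def)
  have pre: "(\<lambda>(a, b). (\<chi> i. if i = 1 then a else b) :: real^2) -` box l u \<inter> space (lborel \<Otimes>\<^sub>M lborel) = {l$1<..<u$1} \<times> {l$2<..<u$2}"
    by (auto simp: mem_box_cart forall_2 space_pair_measure)
  have "emeasure (distr (lborel \<Otimes>\<^sub>M lborel) borel (\<lambda>(a, b). (\<chi> i. if i = 1 then a else b) :: real^2)) (box l u)
    = emeasure (lborel \<Otimes>\<^sub>M lborel) ({l$1<..<u$1} \<times> {l$2<..<u$2})"
    by (subst emeasure_distr[OF m']) (auto simp: pre)
  also have "\<dots> = ennreal (u$1 - l$1) * ennreal (u$2 - l$2)"
    by (subst lborel.emeasure_pair_measure_Times) (auto simp: le')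
  also have "\<dots> = (\<Prod>b\<in>Basis. (u - l) \<bullet> b)"
  proof -
    have B: "(Basis :: (real^2) set) = (\<lambda>i. axis i 1) ` UNIV" by (auto simp: Basis_vec_def)
    have inj: "inj (\<lambda>i::2. axis i (1::real))" by (auto simp: inj_def axis_eq_axis)
    have "(\<Prod>b\<in>Basis. (u - l) \<bullet> b) = (\<Prod>i\<in>(UNIV::2 set). (u - l) $ i)"
      unfolding B by (subst prod.reindex[OF inj]) (simp add: inner_axis)
    also have "\<dots> = (u$1 - l$1) * (u$2 - l$2)" by (simp add: UNIV_2)
    finally show ?thesis using le' by (simp add: ennreal_mult)
  qed
  finally show "emeasure (distr (lborel \<Otimes>\<^sub>M lborel) borel (\<lambda>(a, b). (\<chi> i. if i = 1 then a else b) :: real^2)) (box l u) = (\<Prod>b\<in>Basis. (u - l) \<bullet> b)" .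
qed simp

lemma nn_integral_vec2:
  fixes F :: "real^2 \<Rightarrow> ennreal"
  assumes [measurable]: "F \<in> borel_measurable borel"
  shows "(\<integral>\<^sup>+x. F x \<partial>lborel) = (\<integral>\<^sup>+a. \<integral>\<^sup>+b. F (\<chi> i. if i = 1 then a else b) \<partial>lborel \<partial>lborel)"
    and "(\<lambda>(a, b). F (\<chi> i. if i = 1 then a else b)) \<in> borel_measurable (lborel \<Otimes>\<^sub>M lborel)"
proof -
  note m[measurable] = measurable_vec2
  show *: "(\<lambda>(a, b). F (\<chi> i. if i = 1 then a else b)) \<in> borel_measurable (lborel \<Otimes>\<^sub>M lborel)"
    using measurable_comp[OF m assms] by (simp add: comp_def case_prod_beta)
  have "(\<integral>\<^sup>+x. F x \<partial>lborel) = (\<integral>\<^sup>+z. (case z of (a, b) \<Rightarrow> F (\<chi> i. if i = 1 then a else b)) \<partial>(lborel \<Otimes>\<^sub>M lborel))"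
    by (subst lborel_vec2[symmetric], subst nn_integral_distr[OF m]) (auto simp: case_prod_unfold)
  then show "(\<integral>\<^sup>+x. F x \<partial>lborel) = (\<integral>\<^sup>+a. \<integral>\<^sup>+b. F (\<chi> i. if i = 1 then a else b) \<partial>lborel \<partial>lborel)"
    using lborel.nn_integral_fst[OF *] by simp
qed

text \<open>Integrating the derivative from a point left of the support up to \<open>x\<close>
  recovers \<open>g x\<close>; enlarging the interval to the whole line removes the dependence on
  \<open>x\<close>.\<close>

lemma abs_le_nn_integral_deriv:
  fixes g g' :: "real \<Rightarrow> real"
  assumes der: "\<And>t. (g has_real_derivative g' t) (at t)" and cont: "continuous_on UNIV g'"
    and zero: "\<And>t. \<bar>t\<bar> > R \<Longrightarrow> g t = 0"
  shows "ennreal \<bar>g x\<bar> \<le> (\<integral>\<^sup>+t. ennreal \<bar>g' t\<bar> \<partial>lborel)"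
proof -
  \<comment> \<open>Both \<open>a \<le> x\<close> and \<open>\<bar>a\<bar> > R\<close> hold,
    whatever the signs of \<open>R\<close> and \<open>x\<close>.\<close>
  define a where "a = - (\<bar>R\<bar> + \<bar>x\<bar> + 1)"
  have a: "a \<le> x" "g a = 0" by (auto simp: a_def intro!: zero)
  have ig: "integrable lborel (\<lambda>t. indicator {a..x} t *\<^sub>R g' t)"
    by (rule borel_integrable_compact) (auto intro: continuous_on_subset[OF cont])
  have "(\<integral>t. indicator {a..x} t *\<^sub>R g' t \<partial>lborel) = g x - g a"
  proof (rule integral_FTC_Icc[OF a(1)])
    show "(g has_vector_derivative g' t) (at t within {a..x})" for t
      using has_field_derivative_at_within[OF der[of t]] by (simp add: has_real_derivative_iff_has_vector_derivative)
  qed (rule continuous_on_subset[OF cont], simp)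
  then have "ennreal \<bar>g x\<bar> = ennreal (norm (\<integral>t. indicator {a..x} t *\<^sub>R g' t \<partial>lborel))"
    using a by simp
  also have "\<dots> \<le> (\<integral>\<^sup>+t. norm (indicator {a..x} t *\<^sub>R g' t) \<partial>lborel)"
    by (rule integral_norm_bound_ennreal[OF ig])
  also have "\<dots> \<le> (\<integral>\<^sup>+t. ennreal \<bar>g' t\<bar> \<partial>lborel)"
    by (intro nn_integral_mono ennreal_leI) (auto simp: indicator_def)
  finally show ?thesis .
qed

text \<open>On the horizontal and on the vertical line through a point, \<open>f\<close> is bounded
  by the integral of \<open>norm G\<close> along that line. One bound depends only on the second
  coordinate and the other only on the first, so their product integrates to a product.\<close>

lemma C1_compact_Gagliardo:
  assumes "C1_compact f G"
  shows "(\<integral>\<^sup>+x. ennreal ((f x)\<^sup>2) \<partial>lborel) \<le> (\<integral>\<^sup>+x. ennreal (norm (G x)) \<partial>lborel)\<^sup>2"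
proof -
  from assms obtain R where der: "\<And>x. (f has_derivative (\<lambda>h. G x \<bullet> h)) (at x)"
    and cG: "continuous_on UNIV G" and R: "\<And>x. norm x > R \<Longrightarrow> f x = 0 \<and> G x = 0"
    unfolding C1_compact_def by blast
  have cf: "continuous_on UNIV f" by (rule C1_compact_continuous[OF assms])
  have [measurable]: "f \<in> borel_measurable borel" "G \<in> borel_measurable borel"
    using cf cG by (auto intro: borel_measurable_continuous_onI)
  define P where "P a b = ((\<chi> i. if i = 1 then a else b) :: real^2)" for a b
  have P1: "P a b = a *\<^sub>R axis 1 1 + b *\<^sub>R axis 2 1" for a b
    by (auto simp: P_def vec_eq_iff axis_def forall_2)
  have Rc: "f x = 0" if "\<bar>x $ i\<bar> > R" for x i
    using R[of x] component_le_norm_cart[of x i] that by auto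
  \<comment> \<open>The base point satisfies \<open>c $ i = 0\<close>, so the parameter
    \<open>t\<close> is itself the \<open>i\<close>-th coordinate and the support condition reads
    \<open>\<bar>t\<bar> > R\<close>.\<close>
  have line: "ennreal \<bar>f (c + t *\<^sub>R axis i 1)\<bar> \<le> (\<integral>\<^sup>+s. ennreal (norm (G (c + s *\<^sub>R axis i 1))) \<partial>lborel)"
    if "c $ i = 0" for c t and i :: 2
  proof -
    have "ennreal \<bar>f (c + t *\<^sub>R axis i 1)\<bar> \<le> (\<integral>\<^sup>+s. ennreal \<bar>G (c + s *\<^sub>R axis i 1) $ i\<bar> \<partial>lborel)"
    proof (rule abs_le_nn_integral_deriv[where R=R and g="\<lambda>t. f (c + t *\<^sub>R axis i 1)"])
      fix t
      have "((\<lambda>t. f (c + t *\<^sub>R axis i 1)) has_derivative (\<lambda>h. G (c + t *\<^sub>R axis i 1) \<bullet> (h *\<^sub>R axis i 1))) (at t)"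
        by (rule has_derivative_compose[where g=f and f="\<lambda>t. c + t *\<^sub>R axis i 1" and x=t and s=UNIV])
           (auto intro!: derivative_eq_intros der)
      moreover have "(\<lambda>h. G (c + t *\<^sub>R axis i 1) \<bullet> (h *\<^sub>R axis i 1)) = (*) (G (c + t *\<^sub>R axis i 1) $ i)"
        by (auto simp: inner_axis)
      ultimately show "((\<lambda>t. f (c + t *\<^sub>R axis i 1)) has_real_derivative G (c + t *\<^sub>R axis i 1) $ i) (at t)"
        by (simp add: has_field_derivative_def)
      show "f (c + t *\<^sub>R axis i 1) = 0" if "R < \<bar>t\<bar>"
        using that \<open>c $ i = 0\<close> by (intro Rc[where i=i]) auto
    next
      show "continuous_on UNIV (\<lambda>t. G (c + t *\<^sub>R axis i 1) $ i)"
        by (intro continuous_intros continuous_on_compose2[OF cG]) auto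
    qed
    also have "\<dots> \<le> (\<integral>\<^sup>+s. ennreal (norm (G (c + s *\<^sub>R axis i 1))) \<partial>lborel)"
      by (intro nn_integral_mono ennreal_leI component_le_norm_cart)
    finally show ?thesis .
  qed
  \<comment> \<open>\<open>A\<close> integrates along horizontal lines and \<open>B\<close> along
    vertical ones; by Fubini the total integral of each is that of \<open>norm G\<close>.\<close>
  define A where "A b = (\<integral>\<^sup>+s. ennreal (norm (G (P s b))) \<partial>lborel)" for b
  define B where "B a = (\<integral>\<^sup>+s. ennreal (norm (G (P a s))) \<partial>lborel)" for a
  have mD: "(\<lambda>(a, b). ennreal (norm (G (P a b)))) \<in> borel_measurable (lborel \<Otimes>\<^sub>M lborel)"
    unfolding P_def by (rule nn_integral_vec2(2)) simp
  have [measurable]: "A \<in> borel_measurable borel" "B \<in> borel_measurable borel"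
    using lborel.borel_measurable_nn_integral_fst[OF mD]
      lborel.borel_measurable_nn_integral_fst[OF measurable_pair_swap[OF mD]]
    by (simp_all add: A_def[abs_def] B_def[abs_def])
  have I: "(\<integral>\<^sup>+x. ennreal (norm (G x)) \<partial>lborel) = (\<integral>\<^sup>+a. B a \<partial>lborel)"
    unfolding B_def P_def by (rule nn_integral_vec2(1)) simp
  have I': "(\<integral>\<^sup>+a. B a \<partial>lborel) = (\<integral>\<^sup>+b. A b \<partial>lborel)"
    unfolding A_def B_def by (rule lborel_pair.Fubini'[OF mD, symmetric])
  have pt: "ennreal ((f (P a b))\<^sup>2) \<le> B a * A b" for a b
  proof -
    have "ennreal \<bar>f (P a b)\<bar> \<le> A b"
      using line[of "b *\<^sub>R axis 2 1" 1 a] by (simp add: A_def P1 add.commute) (simp add: axis_def)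
    moreover have "ennreal \<bar>f (P a b)\<bar> \<le> B a"
      using line[of "a *\<^sub>R axis 1 1" 2 b] by (simp add: B_def P1) (simp add: axis_def)
    moreover have "ennreal ((f (P a b))\<^sup>2) = ennreal \<bar>f (P a b)\<bar> * ennreal \<bar>f (P a b)\<bar>"
      by (simp add: ennreal_mult[symmetric] power2_eq_square)
    ultimately show ?thesis by (simp add: mult_mono)
  qed
  have "(\<integral>\<^sup>+x. ennreal ((f x)\<^sup>2) \<partial>lborel) = (\<integral>\<^sup>+a. \<integral>\<^sup>+b. ennreal ((f (P a b))\<^sup>2) \<partial>lborel \<partial>lborel)"
    unfolding P_def by (rule nn_integral_vec2(1)) simp
  also have "\<dots> \<le> (\<integral>\<^sup>+a. \<integral>\<^sup>+b. B a * A b \<partial>lborel \<partial>lborel)"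
    by (intro nn_integral_mono pt)
  also have "\<dots> = (\<integral>\<^sup>+a. B a \<partial>lborel) * (\<integral>\<^sup>+b. A b \<partial>lborel)"
    by (simp add: nn_integral_cmult nn_integral_multc)
  finally show ?thesis by (simp add: I I' power2_eq_square)
qed

section \<open>Smooth functions of compact support and their gradients\<close>

lemma Ck_add_scaled: "Ck k f \<Longrightarrow> Ck k g \<Longrightarrow> Ck k (\<lambda>x. f x + c * g x)"
proof (induction k arbitrary: f g)
  case 0
  then show ?case by (auto intro!: continuous_intros)
next
  case (Suc k)
  from Suc.prems obtain F G where
    F: "\<And>x. (f has_derivative (\<lambda>h. F x \<bullet> h)) (at x)" "continuous_on UNIV f" "\<And>i. Ck k (\<lambda>x. F x $ i)" and
    G: "\<And>x. (g has_derivative (\<lambda>h. G x \<bullet> h)) (at x)" "continuous_on UNIV g" "\<And>i. Ck k (\<lambda>x. G x $ i)"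
    by auto
  have "((\<lambda>x. f x + c * g x) has_derivative (\<lambda>h. (F x + c *\<^sub>R G x) \<bullet> h)) (at x)" for x
    by (auto intro!: derivative_eq_intros F G simp: inner_add_left)
  moreover have "continuous_on UNIV (\<lambda>x. f x + c * g x)"
    by (intro continuous_intros F G)
  moreover have "Ck k (\<lambda>x. (F x + c *\<^sub>R G x) $ i)" for i
    using Suc.IH[OF F(3)[of i] G(3)[of i]] by simp
  ultimately show ?case
    unfolding Ck.simps by (intro exI[of _ "\<lambda>x. F x + c *\<^sub>R G x"]) blast
qed

lemma smooth_compact_support_add_scaled:
  assumes "smooth_compact_support f" "smooth_compact_support g"
  shows "smooth_compact_support (\<lambda>x. f x + c * g x)"
proof -
  have "{x. f x + c * g x \<noteq> 0} \<subseteq> {x. f x \<noteq> 0} \<union> {x. g x \<noteq> 0}" by auto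
  then have "bounded {x. f x + c * g x \<noteq> 0}"
    using assms by (intro bounded_subset[OF bounded_Un[THEN iffD2]]) (auto simp: smooth_compact_support_def)
  then show ?thesis using assms Ck_add_scaled by (auto simp: smooth_compact_support_def)
qed

lemma gradient_eq_0_outside:
  fixes f :: "R2 \<Rightarrow> real"
  assumes "\<And>x. (f has_derivative (\<lambda>h. G x \<bullet> h)) (at x)" "\<And>x. norm x > R \<Longrightarrow> f x = 0" "norm x > R"
  shows "G x = 0"
proof -
  have "open {y::R2. norm y > R}" by (auto intro!: open_Collect_less continuous_intros)
  then have "(f has_derivative (\<lambda>h. 0)) (at x)"
    by (rule has_derivative_transform_within_open[OF has_derivative_const[of 0]]) (use assms in auto)
  then have "(\<lambda>h. G x \<bullet> h) = (\<lambda>h. 0)" using assms(1) has_derivative_unique by blast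
  then show ?thesis by (metis inner_eq_zero_iff)
qed

text \<open>Two derivatives are used: the first gives the gradient, the second makes each of its
  components \<open>C1_compact\<close> again, so that a gradient can itself be a test field in an
  integration by parts.\<close>

lemma smooth_compact_support_C1_compact:
  assumes "smooth_compact_support f" and der: "\<And>x. (f has_derivative (\<lambda>h. G x \<bullet> h)) (at x)"
  shows "C1_compact f G" and "\<exists>H. C1_compact (\<lambda>x. G x $ i) H"
proof -
  have "Ck (Suc (Suc 0)) f" and bd: "bounded (closure {x. f x \<noteq> 0})"
    using assms(1) unfolding smooth_compact_support_def by (blast, blast intro: compact_imp_bounded)
  then obtain G' where G': "\<And>x. (f has_derivative (\<lambda>h. G' x \<bullet> h)) (at x)" "\<And>i. Ck (Suc 0) (\<lambda>x. G' x $ i)"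
    by auto
  \<comment> \<open>The gradient supplied by \<open>Ck\<close> is existential; uniqueness of
    derivatives transfers its regularity to the given \<open>G\<close>.\<close>
  have "G' x = G x" for x
    using has_derivative_unique[OF G'(1) der] by (metis vector_eq_rdot)
  then have G1: "Ck (Suc 0) (\<lambda>x. G x $ i)" for i using G'(2) by simp
  from bd obtain R where R: "\<And>x. x \<in> closure {x. f x \<noteq> 0} \<Longrightarrow> norm x \<le> R"
    by (auto simp: bounded_iff)
  have f0: "f x = 0" if "norm x > R" for x
    using R[of x] that subsetD[OF closure_subset, of x "{x. f x \<noteq> 0}"] by auto
  have G0: "G x = 0" if "norm x > R" for x
    by (rule gradient_eq_0_outside[OF der f0 that])
  have cGi: "continuous_on UNIV (\<lambda>x. G x $ i)" for i using G1[of i] by auto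
  have "continuous_on UNIV (\<lambda>x. \<chi> i. G x $ i)" by (intro continuous_on_vec_lambda cGi)
  then have cG: "continuous_on UNIV G" by simp
  show "C1_compact f G" unfolding C1_compact_def using der cG f0 G0 by blast
  from G1[of i] obtain H where H: "\<And>x. ((\<lambda>x. G x $ i) has_derivative (\<lambda>h. H x \<bullet> h)) (at x)"
    "\<And>j. continuous_on UNIV (\<lambda>x. H x $ j)" by auto
  have "H x = 0" if "norm x > R" for x
    by (rule gradient_eq_0_outside[OF H(1) _ that]) (use G0 in auto)
  moreover have "continuous_on UNIV (\<lambda>x. \<chi> j. H x $ j)" by (intro continuous_on_vec_lambda H)
  then have "continuous_on UNIV H" by simp
  ultimately show "\<exists>H. C1_compact (\<lambda>x. G x $ i) H"
    unfolding C1_compact_def using H(1) G0 by (metis zero_index)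
qed

section \<open>Auxiliary estimates for weighted integrals\<close>

text \<open>From \<open>(a + b)^2 \<le> 2 a^2 + 2 b^2\<close>. A general weight and vector values
  let one statement serve gradients with weight 1 and functions with weight
  \<open>V\<close>.\<close>

lemma nn_integral_weighted_square_add_le:
  fixes a b :: "'a \<Rightarrow> 'b::euclidean_space"
  assumes [measurable]: "w \<in> borel_measurable M" "a \<in> borel_measurable M" "b \<in> borel_measurable M"
    and "\<And>x. w x \<ge> 0"
  shows "(\<integral>\<^sup>+x. ennreal (w x * (norm (a x + b x))\<^sup>2) \<partial>M) \<le>
    2 * (\<integral>\<^sup>+x. ennreal (w x * (norm (a x))\<^sup>2) \<partial>M) + 2 * (\<integral>\<^sup>+x. ennreal (w x * (norm (b x))\<^sup>2) \<partial>M)"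
proof -
  have "w x * (norm (a x + b x))\<^sup>2 \<le> 2 * (w x * (norm (a x))\<^sup>2) + 2 * (w x * (norm (b x))\<^sup>2)" for x
  proof -
    have "(norm (a x + b x))\<^sup>2 \<le> (norm (a x) + norm (b x))\<^sup>2"
      by (intro power_mono norm_triangle_ineq) auto
    also have "\<dots> \<le> 2 * (norm (a x))\<^sup>2 + 2 * (norm (b x))\<^sup>2"
      using sum_squares_bound[of "norm (a x)" "norm (b x)"] by (simp add: power2_sum)
    finally show ?thesis using mult_left_mono[OF _ assms(4)[of x]] by (fastforce simp: algebra_simps)
  qed
  then have "(\<integral>\<^sup>+x. ennreal (w x * (norm (a x + b x))\<^sup>2) \<partial>M) \<le>
    (\<integral>\<^sup>+x. 2 * ennreal (w x * (norm (a x))\<^sup>2) + 2 * ennreal (w x * (norm (b x))\<^sup>2) \<partial>M)"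
  proof (intro nn_integral_mono)
    fix x
    assume *: "\<And>x. w x * (norm (a x + b x))\<^sup>2 \<le> 2 * (w x * (norm (a x))\<^sup>2) + 2 * (w x * (norm (b x))\<^sup>2)"
    have "ennreal (w x * (norm (a x + b x))\<^sup>2) \<le> ennreal (2 * (w x * (norm (a x))\<^sup>2) + 2 * (w x * (norm (b x))\<^sup>2))"
      by (rule ennreal_leI[OF *])
    also have "\<dots> = 2 * ennreal (w x * (norm (a x))\<^sup>2) + 2 * ennreal (w x * (norm (b x))\<^sup>2)"
      using assms(4)[of x] by (simp add: ennreal_plus ennreal_mult)
    finally show "ennreal (w x * (norm (a x + b x))\<^sup>2) \<le> 2 * ennreal (w x * (norm (a x))\<^sup>2) + 2 * ennreal (w x * (norm (b x))\<^sup>2)" .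
  qed
  then show ?thesis by (simp add: nn_integral_add nn_integral_cmult)
qed

text \<open>One endpoint power already dominates: the \<open>m\<close>-th for
  \<open>s \<le> 1\<close>, the \<open>n\<close>-th for \<open>s > 1\<close>. The application has
  exponents 2, \<open>k\<close> and \<open>2 * (k - 1)\<close>, so that only even powers of
  \<open>\<bar>\<phi>\<bar>\<close> enter the recursion.\<close>

lemma power_interpolation:
  fixes s :: real
  assumes "s \<ge> 0" "m \<le> k" "k \<le> n"
  shows "s ^ k \<le> s ^ m + s ^ n"
proof (cases "s \<le> 1")
  case True
  then have "s ^ k \<le> s ^ m" using assms by (intro power_decreasing) auto
  then show ?thesis using zero_le_power[OF assms(1), of n] by linarith
next
  case False
  then have "s ^ k \<le> s ^ n" using assms by (intro power_increasing) auto
  then show ?thesis using zero_le_power[OF assms(1), of m] by linarith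
qed

text \<open>Gagliardo's inequality is applied to these functions. Positivity of \<open>V\<close>
  keeps the square root differentiable, and \<open>k > 0\<close> makes the power vanish wherever
  \<open>\<phi>\<close> does.\<close>

lemma C1_compact_sqrt_mult_power:
  assumes V0: "\<And>x. V x > 0" and dV: "\<And>x. (V has_derivative (\<lambda>h. V' x \<bullet> h)) (at x)"
    and cV': "continuous_on UNIV V'" and "C1_compact \<phi> G" and "k > 0"
  shows "C1_compact (\<lambda>x. sqrt (V x) * \<phi> x ^ k)
    (\<lambda>x. (\<phi> x ^ k / (2 * sqrt (V x))) *\<^sub>R V' x + (sqrt (V x) * (real k * \<phi> x ^ (k - 1))) *\<^sub>R G x)"
proof -
  have c\<phi>: "continuous_on UNIV \<phi>" using assms(4) by (rule C1_compact_continuous)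
  have cV: "continuous_on UNIV V"
    using dV by (meson continuous_at_imp_continuous_on has_derivative_continuous)
  obtain R where d\<phi>: "\<And>x. (\<phi> has_derivative (\<lambda>h. G x \<bullet> h)) (at x)" and cG: "continuous_on UNIV G"
    and R: "\<And>x. norm x > R \<Longrightarrow> \<phi> x = 0 \<and> G x = 0"
    using assms(4) unfolding C1_compact_def by blast
  show ?thesis unfolding C1_compact_def
  proof (intro conjI allI exI[of _ R] impI)
    fix x
    have ds: "((\<lambda>x. sqrt (V x)) has_derivative (\<lambda>h. (V' x \<bullet> h) * (inverse (sqrt (V x)) / 2))) (at x)"
      using has_derivative_real_sqrt[OF V0 dV] by simp
    show "((\<lambda>x. sqrt (V x) * \<phi> x ^ k) has_derivative (\<lambda>h. ((\<phi> x ^ k / (2 * sqrt (V x))) *\<^sub>R V' x + (sqrt (V x) * (real k * \<phi> x ^ (k - 1))) *\<^sub>R G x) \<bullet> h)) (at x)"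
      by (rule has_derivative_eq_rhs, rule has_derivative_mult[OF ds has_derivative_power[OF d\<phi>]])
         (auto simp: fun_eq_iff inner_add_left field_simps)
  next
    show "continuous_on UNIV (\<lambda>x. (\<phi> x ^ k / (2 * sqrt (V x))) *\<^sub>R V' x + (sqrt (V x) * (real k * \<phi> x ^ (k - 1))) *\<^sub>R G x)"
      using V0 by (intro continuous_intros c\<phi> cV cV' cG) (auto simp: less_imp_neq[symmetric])
  qed (use R \<open>k > 0\<close> in auto)
qed

lemma C1_compact_measurable:
  assumes "C1_compact f G"
  shows "f \<in> borel_measurable borel" "G \<in> borel_measurable borel"
  using assms C1_compact_continuous[OF assms]
  by (auto simp: C1_compact_def intro: borel_measurable_continuous_onI)

lemma C1_compact_nn_integral_finite:
  assumes "C1_compact f G" "continuous_on UNIV W" "\<And>x. W x \<ge> 0"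
  shows "(\<integral>\<^sup>+x. ennreal (W x * (norm (f x))\<^sup>2) \<partial>lborel) < \<infinity>"
    and "(\<integral>\<^sup>+x. ennreal (W x * (norm (G x))\<^sup>2) \<partial>lborel) < \<infinity>"
proof -
  have cf: "continuous_on UNIV f" by (rule C1_compact_continuous[OF assms(1)])
  obtain R where cG: "continuous_on UNIV G" and R: "\<And>x. norm x > R \<Longrightarrow> f x = 0 \<and> G x = 0"
    using assms(1) unfolding C1_compact_def by blast
  have "integrable lborel (\<lambda>x. W x * (norm (f x))\<^sup>2)" "integrable lborel (\<lambda>x. W x * (norm (G x))\<^sup>2)"
    by (rule integrable_continuous_compact_support[where R=R]; use R in \<open>auto intro!: continuous_intros assms cf cG\<close>)+
  then show "(\<integral>\<^sup>+x. ennreal (W x * (norm (f x))\<^sup>2) \<partial>lborel) < \<infinity>"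
    and "(\<integral>\<^sup>+x. ennreal (W x * (norm (G x))\<^sup>2) \<partial>lborel) < \<infinity>"
    using assms(3) by (auto simp: integrable_iff_bounded)
qed

section \<open>The potential, and integrability of weighted even powers\<close>

locale coercive_potential =
  fixes V :: "R2 \<Rightarrow> real" and V' :: "R2 \<Rightarrow> R2" and C :: real
  assumes V_pos: "\<And>x. V x > 0"
    and V_deriv: "\<And>x. (V has_derivative (\<lambda>h. V' x \<bullet> h)) (at x)" and V'_cont: "continuous_on UNIV V'"
    and V_coercive: "filterlim V at_top at_infinity"
    and C_pos: "C > 0" and V'_bound: "AE x in lborel. norm (V' x) \<le> C * V x powr (3/2)"
begin

lemma V_cont: "continuous_on UNIV V"
  using V_deriv by (meson continuous_at_imp_continuous_on has_derivative_continuous)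

lemma V_measurable [measurable]: "V \<in> borel_measurable borel"
  using V_cont by (rule borel_measurable_continuous_onI)

lemma V_nonneg: "V x \<ge> 0"
  using V_pos less_imp_le by blast

text \<open>Coercivity bounds \<open>V\<close> below by 1 outside a ball, and on the ball the
  continuous positive function \<open>V\<close> attains its minimum. Weighted L^2 bounds and limits
  therefore imply unweighted ones.\<close>

lemma V_lower_bound:
  obtains c where "c > 0" "\<And>x. c \<le> V x"
proof -
  have "eventually (\<lambda>x. V x \<ge> 1) at_infinity"
    using V_coercive by (simp add: filterlim_at_top)
  then obtain b where b: "\<And>x. norm x \<ge> b \<Longrightarrow> V x \<ge> 1" by (auto simp: eventually_at_infinity)
  have "\<exists>y\<in>cball 0 \<bar>b\<bar>. \<forall>x\<in>cball 0 \<bar>b\<bar>. V y \<le> V x"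
    by (rule continuous_attains_inf) (auto intro: continuous_on_subset[OF V_cont])
  then obtain y where y: "\<And>x. norm x \<le> \<bar>b\<bar> \<Longrightarrow> V y \<le> V x" by (metis mem_cball_0)
  have "min 1 (V y) \<le> V x" for x
    using y[of x] b[of x] by linarith
  then show ?thesis using that[of "min 1 (V y)"] V_pos[of y] by auto
qed

text \<open>Gagliardo's inequality for \<open>sqrt (V x) * \<phi> x ^ k\<close>. One term of its
  gradient contains \<open>V'\<close> and the other \<open>G\<close>; both are bounded through the
  exponents 2 and \<open>2 * (k - 1)\<close> alone, which makes an induction on \<open>k\<close>
  possible.\<close>

lemma weighted_power_step:
  assumes \<phi>: "C1_compact \<phi> G" and k: "k \<ge> 2"
  shows "(\<integral>\<^sup>+x. ennreal (V x * \<bar>\<phi> x\<bar> ^ (2 * k)) \<partial>lborel) \<le>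
    (ennreal (C / 2) * ((\<integral>\<^sup>+x. ennreal (V x * \<bar>\<phi> x\<bar> ^ 2) \<partial>lborel) + (\<integral>\<^sup>+x. ennreal (V x * \<bar>\<phi> x\<bar> ^ (2 * (k - 1))) \<partial>lborel)) +
     ennreal (real k) * ((\<integral>\<^sup>+x. ennreal (V x * \<bar>\<phi> x\<bar> ^ (2 * (k - 1))) \<partial>lborel) + (\<integral>\<^sup>+x. ennreal ((norm (G x))\<^sup>2) \<partial>lborel)))\<^sup>2"
  (is "_ \<le> (?c * (?A2 + ?A) + ?k * (?A + ?B))\<^sup>2")
proof -
  note [measurable] = C1_compact_measurable[OF \<phi>]
  define f where "f x = sqrt (V x) * \<phi> x ^ k" for x
  define F where "F x = (\<phi> x ^ k / (2 * sqrt (V x))) *\<^sub>R V' x + (sqrt (V x) * (real k * \<phi> x ^ (k - 1))) *\<^sub>R G x" for x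
  have fF: "C1_compact f F"
    unfolding f_def F_def using k
    by (intro C1_compact_sqrt_mult_power V_pos V_deriv V'_cont \<phi>) auto
  have f2: "V x * \<bar>\<phi> x\<bar> ^ (2 * k) = (f x)\<^sup>2" for x
    using V_nonneg[of x] by (simp add: f_def power_mult_distrib power_mult power_even_abs mult.commute[of 2 k] flip: power_abs)
  have bound: "norm (F x) \<le> C / 2 * (V x * \<bar>\<phi> x\<bar> ^ 2 + V x * \<bar>\<phi> x\<bar> ^ (2 * (k - 1))) + real k * (V x * \<bar>\<phi> x\<bar> ^ (2 * (k - 1)) + (norm (G x))\<^sup>2)"
    if V': "norm (V' x) \<le> C * V x powr (3/2)" for x
  proof -
    \<comment> \<open>With \<open>s\<close> the square root, \<open>V x powr (3/2)\<close> is
      \<open>V x * s\<close>: dividing by \<open>2 * s\<close> leaves exactly the weight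
      \<open>V x\<close>. This is where the growth condition on \<open>V'\<close> has the right
      exponent.\<close>
    define s where "s = sqrt (V x)"
    have s: "s > 0" "V x = s\<^sup>2" using V_pos[of x] by (auto simp: s_def less_imp_le)
    have "V x powr (3/2) = V x powr (1 + 1/2)" by simp
    also have "\<dots> = V x * s" using V_pos[of x] by (simp only: powr_add powr_one powr_half_sqrt s_def less_imp_le)
    finally have pw: "V x powr (3/2) = V x * s" .
    have "norm ((\<phi> x ^ k / (2 * s)) *\<^sub>R V' x) = (\<bar>\<phi> x\<bar> ^ k / (2 * s)) * norm (V' x)"
      using s by (simp add: power_abs)
    also have "\<dots> \<le> (\<bar>\<phi> x\<bar> ^ k / (2 * s)) * (C * (V x * s))"
      using s V' pw by (intro mult_left_mono) auto
    also have "\<dots> = C / 2 * V x * \<bar>\<phi> x\<bar> ^ k" using s(1) by (simp add: field_simps)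
    \<comment> \<open>\<open>k \<ge> 2\<close> puts \<open>k\<close> between 2 and
      \<open>2 * (k - 1)\<close>.\<close>
    also have "\<dots> \<le> C / 2 * V x * (\<bar>\<phi> x\<bar> ^ 2 + \<bar>\<phi> x\<bar> ^ (2 * (k - 1)))"
      using k C_pos V_nonneg[of x] by (intro mult_left_mono power_interpolation) auto
    finally have 1: "norm ((\<phi> x ^ k / (2 * s)) *\<^sub>R V' x) \<le> C / 2 * (V x * \<bar>\<phi> x\<bar> ^ 2 + V x * \<bar>\<phi> x\<bar> ^ (2 * (k - 1)))"
      by (simp add: algebra_simps)
    have "norm ((s * (real k * \<phi> x ^ (k - 1))) *\<^sub>R G x) = real k * ((s * \<bar>\<phi> x\<bar> ^ (k - 1)) * norm (G x))"
      using s by (simp add: abs_mult power_abs)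
    \<comment> \<open>A product is at most the sum of the squares, which separates the weighted
      power from the squared gradient.\<close>
    also have "\<dots> \<le> real k * ((s * \<bar>\<phi> x\<bar> ^ (k - 1))\<^sup>2 + (norm (G x))\<^sup>2)"
    proof (rule mult_left_mono)
      have "2 * (s * \<bar>\<phi> x\<bar> ^ (k - 1)) * norm (G x) \<le> (s * \<bar>\<phi> x\<bar> ^ (k - 1))\<^sup>2 + (norm (G x))\<^sup>2"
        by (rule sum_squares_bound)
      moreover have "0 \<le> (s * \<bar>\<phi> x\<bar> ^ (k - 1)) * norm (G x)" using s by auto
      ultimately show "(s * \<bar>\<phi> x\<bar> ^ (k - 1)) * norm (G x) \<le> (s * \<bar>\<phi> x\<bar> ^ (k - 1))\<^sup>2 + (norm (G x))\<^sup>2"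
        by linarith
    qed simp
    also have "(s * \<bar>\<phi> x\<bar> ^ (k - 1))\<^sup>2 = V x * \<bar>\<phi> x\<bar> ^ (2 * (k - 1))"
      by (simp only: s power_mult_distrib power_mult[symmetric] mult.commute[of 2])
    finally have 2: "norm ((s * (real k * \<phi> x ^ (k - 1))) *\<^sub>R G x) \<le> real k * (V x * \<bar>\<phi> x\<bar> ^ (2 * (k - 1)) + (norm (G x))\<^sup>2)" .
    show ?thesis unfolding F_def using 1 2 norm_triangle_le[OF add_mono[OF 1 2]] by (simp add: s_def)
  qed
  have "(\<integral>\<^sup>+x. ennreal (norm (F x)) \<partial>lborel) \<le> (\<integral>\<^sup>+x. ?c * (ennreal (V x * \<bar>\<phi> x\<bar> ^ 2) + ennreal (V x * \<bar>\<phi> x\<bar> ^ (2 * (k - 1)))) + ?k * (ennreal (V x * \<bar>\<phi> x\<bar> ^ (2 * (k - 1))) + ennreal ((norm (G x))\<^sup>2)) \<partial>lborel)"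
  proof (rule nn_integral_mono_AE)
    show "AE x in lborel. ennreal (norm (F x)) \<le> ?c * (ennreal (V x * \<bar>\<phi> x\<bar> ^ 2) + ennreal (V x * \<bar>\<phi> x\<bar> ^ (2 * (k - 1)))) + ?k * (ennreal (V x * \<bar>\<phi> x\<bar> ^ (2 * (k - 1))) + ennreal ((norm (G x))\<^sup>2))"
      using V'_bound
    proof eventually_elim
      case (elim x)
      have "ennreal (norm (F x)) \<le> ennreal (C / 2 * (V x * \<bar>\<phi> x\<bar> ^ 2 + V x * \<bar>\<phi> x\<bar> ^ (2 * (k - 1))) + real k * (V x * \<bar>\<phi> x\<bar> ^ (2 * (k - 1)) + (norm (G x))\<^sup>2))"
        by (rule ennreal_leI[OF bound[OF elim]])
      also have "\<dots> = ?c * (ennreal (V x * \<bar>\<phi> x\<bar> ^ 2) + ennreal (V x * \<bar>\<phi> x\<bar> ^ (2 * (k - 1)))) + ?k * (ennreal (V x * \<bar>\<phi> x\<bar> ^ (2 * (k - 1))) + ennreal ((norm (G x))\<^sup>2))"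
        using V_nonneg[of x] C_pos by (simp only: ennreal_plus ennreal_mult add_nonneg_nonneg mult_nonneg_nonneg zero_le_power abs_ge_zero norm_ge_zero of_nat_0_le_iff divide_nonneg_pos zero_less_numeral less_imp_le)
      finally show ?case .
    qed
  qed
  also have "\<dots> = ?c * (?A2 + ?A) + ?k * (?A + ?B)"
    by (simp add: nn_integral_add nn_integral_cmult del: power2_abs)
  finally have "(\<integral>\<^sup>+x. ennreal (norm (F x)) \<partial>lborel) \<le> ?c * (?A2 + ?A) + ?k * (?A + ?B)" .
  then have "(\<integral>\<^sup>+x. ennreal (norm (F x)) \<partial>lborel)\<^sup>2 \<le> (?c * (?A2 + ?A) + ?k * (?A + ?B))\<^sup>2"
    by (intro power_mono) auto
  then show ?thesis
    using C1_compact_Gagliardo[OF fF] unfolding f2 by (rule order_trans[rotated])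
qed

text \<open>\<open>K\<close> depends on \<open>M\<close> and \<open>j\<close> but not on
  \<open>\<phi>\<close>, so it bounds a whole approximating sequence at once. Induction on
  \<open>j\<close> iterates \<open>weighted_power_step\<close>, starting from exponent 2 with
  \<open>K = M\<close>.\<close>

lemma weighted_power_bound:
  assumes "M \<ge> 0"
  shows "\<exists>K\<ge>0. \<forall>\<phi> G. C1_compact \<phi> G \<longrightarrow> (\<integral>\<^sup>+x. ennreal (V x * \<bar>\<phi> x\<bar> ^ 2) \<partial>lborel) \<le> ennreal M \<longrightarrow>
     (\<integral>\<^sup>+x. ennreal ((norm (G x))\<^sup>2) \<partial>lborel) \<le> ennreal M \<longrightarrow>
     (\<integral>\<^sup>+x. ennreal (V x * \<bar>\<phi> x\<bar> ^ (2 * Suc j)) \<partial>lborel) \<le> ennreal K"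
proof (induction j)
  case 0
  then show ?case using assms by (intro exI[of _ M]) (simp add: numeral_2_eq_2)
next
  case (Suc j)
  then obtain K where "K \<ge> 0" and K: "\<And>\<phi> G. C1_compact \<phi> G \<Longrightarrow> (\<integral>\<^sup>+x. ennreal (V x * \<bar>\<phi> x\<bar> ^ 2) \<partial>lborel) \<le> ennreal M \<Longrightarrow>
     (\<integral>\<^sup>+x. ennreal ((norm (G x))\<^sup>2) \<partial>lborel) \<le> ennreal M \<Longrightarrow>
     (\<integral>\<^sup>+x. ennreal (V x * \<bar>\<phi> x\<bar> ^ (2 * Suc j)) \<partial>lborel) \<le> ennreal K" by blast
  \<comment> \<open>The right-hand side of \<open>weighted_power_step\<close> for
    \<open>k = Suc (Suc j)\<close>, with the bounds \<open>M\<close> and \<open>K\<close>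
    inserted.\<close>
  define L where "L = (C / 2 * (M + K) + real (Suc (Suc j)) * (K + M))\<^sup>2"
  have "(\<integral>\<^sup>+x. ennreal (V x * \<bar>\<phi> x\<bar> ^ (2 * Suc (Suc j))) \<partial>lborel) \<le> ennreal L"
    if \<phi>: "C1_compact \<phi> G" and A: "(\<integral>\<^sup>+x. ennreal (V x * \<bar>\<phi> x\<bar> ^ 2) \<partial>lborel) \<le> ennreal M"
      and B: "(\<integral>\<^sup>+x. ennreal ((norm (G x))\<^sup>2) \<partial>lborel) \<le> ennreal M" for \<phi> G
  proof -
    have "(\<integral>\<^sup>+x. ennreal (V x * \<bar>\<phi> x\<bar> ^ (2 * Suc (Suc j))) \<partial>lborel) \<le>
      (ennreal (C / 2) * ((\<integral>\<^sup>+x. ennreal (V x * \<bar>\<phi> x\<bar> ^ 2) \<partial>lborel) + (\<integral>\<^sup>+x. ennreal (V x * \<bar>\<phi> x\<bar> ^ (2 * Suc j)) \<partial>lborel)) +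
     ennreal (real (Suc (Suc j))) * ((\<integral>\<^sup>+x. ennreal (V x * \<bar>\<phi> x\<bar> ^ (2 * Suc j)) \<partial>lborel) + (\<integral>\<^sup>+x. ennreal ((norm (G x))\<^sup>2) \<partial>lborel)))\<^sup>2"
      using weighted_power_step[OF \<phi>, of "Suc (Suc j)"] by (simp only: diff_Suc_1)
    also have "\<dots> \<le> (ennreal (C / 2) * (ennreal M + ennreal K) + ennreal (real (Suc (Suc j))) * (ennreal K + ennreal M))\<^sup>2"
      by (intro power_mono add_mono mult_left_mono A B K[OF \<phi>]) auto
    also have "\<dots> = ennreal L"
    proof -
      have "ennreal (C / 2) * (ennreal M + ennreal K) = ennreal (C / 2 * (M + K))"
        "ennreal (real (Suc (Suc j))) * (ennreal K + ennreal M) = ennreal (real (Suc (Suc j)) * (K + M))"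
        using assms \<open>K \<ge> 0\<close> C_pos by (simp_all only: ennreal_plus ennreal_mult add_nonneg_nonneg of_nat_0_le_iff divide_nonneg_pos zero_less_numeral less_imp_le)
      then show ?thesis
        using assms \<open>K \<ge> 0\<close> C_pos
        by (simp only: L_def ennreal_power ennreal_plus[symmetric] mult_nonneg_nonneg add_nonneg_nonneg of_nat_0_le_iff divide_nonneg_pos zero_less_numeral less_imp_le)
    qed
    finally show ?thesis .
  qed
  then show ?case by (intro exI[of _ L]) (simp add: L_def)
qed

text \<open>Passing to a tail of the sequence makes both squared distances at most 1 for every
  index, whence the uniform bounds used below.\<close>

lemma H1V_pair_approx:
  assumes "H1V_pair V u g"
  obtains \<phi> G where "\<And>n. smooth_compact_support (\<phi> n)" "\<And>n x. (\<phi> n has_derivative (\<lambda>h. G n x \<bullet> h)) (at x)"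
    "\<And>n. C1_compact (\<phi> n) (G n)"
    "\<And>n. (\<integral>\<^sup>+x. ennreal ((norm (G n x - g x))\<^sup>2) \<partial>lborel) \<le> 1"
    "\<And>n. (\<integral>\<^sup>+x. ennreal (V x * (\<phi> n x - u x)\<^sup>2) \<partial>lborel) \<le> 1"
    "(\<lambda>n. \<integral>\<^sup>+x. ennreal ((norm (G n x - g x))\<^sup>2) \<partial>lborel) \<longlonglongrightarrow> 0"
    "(\<lambda>n. \<integral>\<^sup>+x. ennreal (V x * (\<phi> n x - u x)\<^sup>2) \<partial>lborel) \<longlonglongrightarrow> 0"
proof -
  from assms obtain \<phi> G where s: "\<And>n. smooth_compact_support (\<phi> n)"
    and d: "\<And>n x. (\<phi> n has_derivative (\<lambda>h. G n x \<bullet> h)) (at x)"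
    and 1: "(\<lambda>n. \<integral>\<^sup>+x. ennreal ((norm (G n x - g x))\<^sup>2) \<partial>lborel) \<longlonglongrightarrow> 0"
    and 2: "(\<lambda>n. \<integral>\<^sup>+x. ennreal (V x * (\<phi> n x - u x)\<^sup>2) \<partial>lborel) \<longlonglongrightarrow> 0"
    unfolding H1V_pair_def by blast
  have "eventually (\<lambda>n. (\<integral>\<^sup>+x. ennreal ((norm (G n x - g x))\<^sup>2) \<partial>lborel) < 1 \<and>
      (\<integral>\<^sup>+x. ennreal (V x * (\<phi> n x - u x)\<^sup>2) \<partial>lborel) < 1) sequentially"
    using order_tendstoD(2)[OF 1, of 1] order_tendstoD(2)[OF 2, of 1] by (auto intro: eventually_conj)
  then obtain N where N: "\<And>n. n \<ge> N \<Longrightarrow> (\<integral>\<^sup>+x. ennreal ((norm (G n x - g x))\<^sup>2) \<partial>lborel) < 1 \<and>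
      (\<integral>\<^sup>+x. ennreal (V x * (\<phi> n x - u x)\<^sup>2) \<partial>lborel) < 1" by (auto simp: eventually_sequentially)
  show ?thesis
  proof (rule that[of "\<lambda>n. \<phi> (n + N)" "\<lambda>n. G (n + N)"])
    show "C1_compact (\<phi> (n + N)) (G (n + N))" for n
      by (rule smooth_compact_support_C1_compact(1)[OF s d])
  qed (use s d N LIMSEQ_ignore_initial_segment[OF 1, of N] LIMSEQ_ignore_initial_segment[OF 2, of N] in \<open>auto simp: less_imp_le\<close>)
qed

lemma H1V_pair_measurable:
  assumes "H1V_pair V u g" shows "u \<in> borel_measurable borel" "g \<in> borel_measurable borel"
  using assms by (auto simp: H1V_pair_def)

text \<open>A single approximant suffices: \<open>u = (u - \<phi> 0) + \<phi> 0\<close> splits into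
  a term of finite norm and a continuous function of compact support, and likewise for
  \<open>g\<close>.\<close>

lemma H1V_pair_square_integrable:
  assumes "H1V_pair V u g"
  shows "integrable lborel (\<lambda>x. (norm (g x))\<^sup>2)" "integrable lborel (\<lambda>x. V x * (u x)\<^sup>2)"
    "integrable lborel (\<lambda>x. (u x)\<^sup>2)"
proof -
  note [measurable] = H1V_pair_measurable[OF assms]
  obtain \<phi> and G :: "nat \<Rightarrow> R2 \<Rightarrow> R2" where \<phi>: "\<And>n. C1_compact (\<phi> n) (G n)"
    "\<And>n. (\<integral>\<^sup>+x. ennreal ((norm (G n x - g x))\<^sup>2) \<partial>lborel) \<le> 1"
    "\<And>n. (\<integral>\<^sup>+x. ennreal (V x * (\<phi> n x - u x)\<^sup>2) \<partial>lborel) \<le> 1"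
    by (rule H1V_pair_approx[OF assms]) (rule that)
  note [measurable] = C1_compact_measurable[OF \<phi>(1)]
  have "(\<integral>\<^sup>+x. ennreal (1 * (norm ((g x - G 0 x) + G 0 x))\<^sup>2) \<partial>lborel) \<le>
    2 * (\<integral>\<^sup>+x. ennreal (1 * (norm (g x - G 0 x))\<^sup>2) \<partial>lborel) + 2 * (\<integral>\<^sup>+x. ennreal (1 * (norm (G 0 x))\<^sup>2) \<partial>lborel)"
    by (rule nn_integral_weighted_square_add_le) auto
  also have "\<dots> < \<infinity>"
    using order_le_less_trans[OF \<phi>(2)[of 0]] C1_compact_nn_integral_finite(2)[OF \<phi>(1)[of 0], of "\<lambda>_. 1"]
    by (auto simp: norm_minus_commute ennreal_mult_less_top)
  finally show "integrable lborel (\<lambda>x. (norm (g x))\<^sup>2)" by (auto simp: integrable_iff_bounded)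
  have "(\<integral>\<^sup>+x. ennreal (V x * (norm ((u x - \<phi> 0 x) + \<phi> 0 x))\<^sup>2) \<partial>lborel) \<le>
    2 * (\<integral>\<^sup>+x. ennreal (V x * (norm (u x - \<phi> 0 x))\<^sup>2) \<partial>lborel) + 2 * (\<integral>\<^sup>+x. ennreal (V x * (norm (\<phi> 0 x))\<^sup>2) \<partial>lborel)"
    by (rule nn_integral_weighted_square_add_le) (auto simp: V_nonneg)
  also have "\<dots> < \<infinity>"
    using order_le_less_trans[OF \<phi>(3)[of 0]] C1_compact_nn_integral_finite(1)[OF \<phi>(1)[of 0] V_cont V_nonneg]
    by (auto simp: power2_commute ennreal_mult_less_top)
  finally show *: "integrable lborel (\<lambda>x. V x * (u x)\<^sup>2)"
    by (auto simp: integrable_iff_bounded abs_mult V_nonneg)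
  obtain c where c: "c > 0" "\<And>x. c \<le> V x" by (rule V_lower_bound) blast
  show "integrable lborel (\<lambda>x. (u x)\<^sup>2)"
  proof (rule Bochner_Integration.integrable_bound)
    show "integrable lborel (\<lambda>x. V x * (u x)\<^sup>2 / c)" using * by simp
    show "AE x in lborel. norm ((u x)\<^sup>2) \<le> norm (V x * (u x)\<^sup>2 / c)"
      using c by (auto simp: field_simps V_nonneg intro!: mult_right_mono AE_I2)
  qed simp
qed

text \<open>The uniform bound on the approximants survives the limit by Fatou's lemma. Real
  exponents follow by interpolation in \<open>H1V_powr_integrable\<close>.\<close>

lemma H1V_pair_power_integrable:
  assumes "H1V_pair V u g"
  shows "integrable lborel (\<lambda>x. V x * \<bar>u x\<bar> ^ (2 * Suc j))"
proof -
  note [measurable] = H1V_pair_measurable[OF assms]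
  obtain \<phi> and G :: "nat \<Rightarrow> R2 \<Rightarrow> R2" where \<phi>: "\<And>n. C1_compact (\<phi> n) (G n)"
    "\<And>n. (\<integral>\<^sup>+x. ennreal ((norm (G n x - g x))\<^sup>2) \<partial>lborel) \<le> 1"
    "\<And>n. (\<integral>\<^sup>+x. ennreal (V x * (\<phi> n x - u x)\<^sup>2) \<partial>lborel) \<le> 1"
    "(\<lambda>n. \<integral>\<^sup>+x. ennreal (V x * (\<phi> n x - u x)\<^sup>2) \<partial>lborel) \<longlonglongrightarrow> 0"
    by (rule H1V_pair_approx[OF assms]) (rule that)
  note [measurable] = C1_compact_measurable[OF \<phi>(1)]
  note int = H1V_pair_square_integrable[OF assms]
  \<comment> \<open>The squared norm of an approximant is at most twice its squared distance to the
    limit, hence 2, plus twice the squared norm of the limit. Adding both norms gives one constant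
    for functions and gradients.\<close>
  define M where "M = 2 + 2 * (\<integral>x. (norm (g x))\<^sup>2 \<partial>lborel) + 2 * (\<integral>x. V x * (u x)\<^sup>2 \<partial>lborel)"
  have nn: "(\<integral>x. (norm (g x))\<^sup>2 \<partial>lborel) \<ge> 0" "(\<integral>x. V x * (u x)\<^sup>2 \<partial>lborel) \<ge> 0"
    by (auto simp: V_nonneg intro!: integral_nonneg)
  then have "M \<ge> 0" by (simp add: M_def)
  have 1: "(\<integral>\<^sup>+x. ennreal ((norm (G n x))\<^sup>2) \<partial>lborel) \<le> ennreal M" for n
  proof -
    have "(\<integral>\<^sup>+x. ennreal (1 * (norm ((G n x - g x) + g x))\<^sup>2) \<partial>lborel) \<le>
    2 * (\<integral>\<^sup>+x. ennreal (1 * (norm (G n x - g x))\<^sup>2) \<partial>lborel) + 2 * (\<integral>\<^sup>+x. ennreal (1 * (norm (g x))\<^sup>2) \<partial>lborel)"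
      by (rule nn_integral_weighted_square_add_le) auto
    also have "\<dots> \<le> 2 * 1 + 2 * ennreal (\<integral>x. (norm (g x))\<^sup>2 \<partial>lborel)"
      using \<phi>(2)[of n] int(1) by (intro add_mono mult_left_mono) (auto simp: nn_integral_eq_integral)
    also have "\<dots> = ennreal (2 + 2 * (\<integral>x. (norm (g x))\<^sup>2 \<partial>lborel))"
      using nn by (simp add: ennreal_plus ennreal_mult)
    also have "\<dots> \<le> ennreal M" by (rule ennreal_leI) (use nn in \<open>simp add: M_def\<close>)
    finally show ?thesis by simp
  qed
  have 2: "(\<integral>\<^sup>+x. ennreal (V x * \<bar>\<phi> n x\<bar> ^ 2) \<partial>lborel) \<le> ennreal M" for n
  proof -
    have "(\<integral>\<^sup>+x. ennreal (V x * (norm ((\<phi> n x - u x) + u x))\<^sup>2) \<partial>lborel) \<le>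
    2 * (\<integral>\<^sup>+x. ennreal (V x * (norm (\<phi> n x - u x))\<^sup>2) \<partial>lborel) + 2 * (\<integral>\<^sup>+x. ennreal (V x * (norm (u x))\<^sup>2) \<partial>lborel)"
      by (rule nn_integral_weighted_square_add_le) (auto simp: V_nonneg)
    also have "\<dots> \<le> 2 * 1 + 2 * ennreal (\<integral>x. V x * (u x)\<^sup>2 \<partial>lborel)"
      using \<phi>(3)[of n] int(2) by (intro add_mono mult_left_mono) (auto simp: nn_integral_eq_integral V_nonneg)
    also have "\<dots> = ennreal (2 + 2 * (\<integral>x. V x * (u x)\<^sup>2 \<partial>lborel))"
      using nn by (simp add: ennreal_plus ennreal_mult)
    also have "\<dots> \<le> ennreal M" by (rule ennreal_leI) (use nn in \<open>simp add: M_def\<close>)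
    finally show ?thesis by simp
  qed
  obtain K where K: "\<And>n. (\<integral>\<^sup>+x. ennreal (V x * \<bar>\<phi> n x\<bar> ^ (2 * Suc j)) \<partial>lborel) \<le> ennreal K"
    using weighted_power_bound[OF \<open>M \<ge> 0\<close>, of j] \<phi>(1) 1 2 by blast
  \<comment> \<open>\<open>d n\<close> tends to 0 in L^1, hence almost everywhere along a
    subsequence \<open>r\<close>; dividing by \<open>V x > 0\<close> yields convergence of
    \<open>\<phi> (r n) x\<close> to \<open>u x\<close>.\<close>
  define d where "d n x = V x * (\<phi> n x - u x)\<^sup>2" for n x
  have dm[measurable]: "d n \<in> borel_measurable borel" for n unfolding d_def[abs_def] by measurable
  have d0: "d n x \<ge> 0" for n x by (simp add: d_def V_nonneg)
  have di: "integrable lborel (d n)" for n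
    using order_le_less_trans[OF \<phi>(3)[of n]] d0 by (auto simp: integrable_iff_bounded simp flip: d_def)
  have "(\<lambda>n. ennreal (\<integral>x. norm (d n x) \<partial>lborel)) \<longlonglongrightarrow> ennreal 0"
    using \<phi>(4) di d0 by (simp add: nn_integral_eq_integral flip: d_def)
  then have "(\<lambda>n. \<integral>x. norm (d n x) \<partial>lborel) \<longlonglongrightarrow> 0"
    using tendsto_ennreal_iff[of "\<lambda>n. \<integral>x. norm (d n x) \<partial>lborel" sequentially 0] by simp
  from tendsto_L1_AE_subseq[OF di this] obtain r where
    r: "AE x in lborel. (\<lambda>n. d (r n) x) \<longlonglongrightarrow> 0" by blast
  have lim: "AE x in lborel. ennreal (V x * \<bar>u x\<bar> ^ (2 * Suc j)) = liminf (\<lambda>n. ennreal (V x * \<bar>\<phi> (r n) x\<bar> ^ (2 * Suc j)))"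
    using r
  proof eventually_elim
    case (elim x)
    have "(\<lambda>n. d (r n) x / V x) \<longlonglongrightarrow> 0 / V x" by (intro tendsto_intros elim) (use V_pos[of x] in auto)
    then have "(\<lambda>n. (\<phi> (r n) x - u x)\<^sup>2) \<longlonglongrightarrow> 0" using V_pos[of x] by (simp add: d_def less_imp_neq[symmetric])
    then have "(\<lambda>n. sqrt ((\<phi> (r n) x - u x)\<^sup>2)) \<longlonglongrightarrow> sqrt 0" by (intro tendsto_intros)
    then have "(\<lambda>n. \<phi> (r n) x - u x) \<longlonglongrightarrow> 0" by (simp add: tendsto_rabs_zero_iff)
    then have "(\<lambda>n. \<phi> (r n) x) \<longlonglongrightarrow> u x" by (simp add: LIM_zero_iff)
    then have "(\<lambda>n. ennreal (V x * \<bar>\<phi> (r n) x\<bar> ^ (2 * Suc j))) \<longlonglongrightarrow> ennreal (V x * \<bar>u x\<bar> ^ (2 * Suc j))"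
      by (intro tendsto_intros)
    then show ?case by (simp add: lim_imp_Liminf)
  qed
  have "(\<integral>\<^sup>+x. ennreal (V x * \<bar>u x\<bar> ^ (2 * Suc j)) \<partial>lborel) = (\<integral>\<^sup>+x. liminf (\<lambda>n. ennreal (V x * \<bar>\<phi> (r n) x\<bar> ^ (2 * Suc j))) \<partial>lborel)"
    by (rule nn_integral_cong_AE[OF lim])
  also have "\<dots> \<le> liminf (\<lambda>n. \<integral>\<^sup>+x. ennreal (V x * \<bar>\<phi> (r n) x\<bar> ^ (2 * Suc j)) \<partial>lborel)"
    by (rule nn_integral_liminf) measurable
  also have "\<dots> \<le> ennreal K" by (intro Liminf_le always_eventually allI K) simp
  also have "\<dots> < \<infinity>" by simp
  finally show ?thesis by (auto simp: integrable_iff_bounded abs_mult V_nonneg)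
qed

end

section \<open>Square-integrable fields and integration by parts\<close>

lemma integrable_inner_of_square_integrable:
  fixes f g :: "'a \<Rightarrow> 'b::euclidean_space"
  assumes [measurable]: "f \<in> borel_measurable M" "g \<in> borel_measurable M"
    and "integrable M (\<lambda>x. (norm (f x))\<^sup>2)" "integrable M (\<lambda>x. (norm (g x))\<^sup>2)"
  shows "integrable M (\<lambda>x. f x \<bullet> g x)"
proof (rule Bochner_Integration.integrable_bound)
  show "integrable M (\<lambda>x. (norm (f x))\<^sup>2 + (norm (g x))\<^sup>2)" using assms by simp
  have "\<bar>f x \<bullet> g x\<bar> \<le> (norm (f x))\<^sup>2 + (norm (g x))\<^sup>2" for x
  proof -
    have "\<bar>f x \<bullet> g x\<bar> \<le> norm (f x) * norm (g x)" by (rule Cauchy_Schwarz_ineq2)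
    moreover have "0 \<le> norm (f x) * norm (g x)" by simp
    ultimately show ?thesis using sum_squares_bound[of "norm (f x)" "norm (g x)"] by linarith
  qed
  then show "AE x in M. norm (f x \<bullet> g x) \<le> norm ((norm (f x))\<^sup>2 + (norm (g x))\<^sup>2)" by (auto intro!: AE_I2)
qed measurable

lemma integral_inner_Cauchy_Schwarz:
  fixes f g :: "'a \<Rightarrow> 'b::euclidean_space"
  assumes [measurable]: "f \<in> borel_measurable M" "g \<in> borel_measurable M"
    and f: "integrable M (\<lambda>x. (norm (f x))\<^sup>2)" and g: "integrable M (\<lambda>x. (norm (g x))\<^sup>2)"
  shows "\<bar>\<integral>x. f x \<bullet> g x \<partial>M\<bar> \<le> sqrt (\<integral>x. (norm (f x))\<^sup>2 \<partial>M) * sqrt (\<integral>x. (norm (g x))\<^sup>2 \<partial>M)"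
proof -
  have int: "integrable M (\<lambda>x. f x \<bullet> g x)"
    by (rule integrable_inner_of_square_integrable) fact+
  have "ennreal \<bar>\<integral>x. f x \<bullet> g x \<partial>M\<bar> \<le> (\<integral>\<^sup>+x. norm (f x \<bullet> g x) \<partial>M)"
    using integral_norm_bound_ennreal[OF int] by simp
  also have "\<dots> \<le> (\<integral>\<^sup>+x. ennreal (norm (f x)) * ennreal (norm (g x)) \<partial>M)"
    by (intro nn_integral_mono) (simp add: ennreal_mult[symmetric] Cauchy_Schwarz_ineq2)
  finally have "(ennreal \<bar>\<integral>x. f x \<bullet> g x \<partial>M\<bar>)\<^sup>2 \<le> (\<integral>\<^sup>+x. ennreal (norm (f x)) * ennreal (norm (g x)) \<partial>M)\<^sup>2"
    by (intro power_mono) auto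
  also have "\<dots> \<le> (\<integral>\<^sup>+x. (ennreal (norm (f x)))\<^sup>2 \<partial>M) * (\<integral>\<^sup>+x. (ennreal (norm (g x)))\<^sup>2 \<partial>M)"
    by (rule Cauchy_Schwarz_nn_integral) measurable
  also have "\<dots> = ennreal ((\<integral>x. (norm (f x))\<^sup>2 \<partial>M) * (\<integral>x. (norm (g x))\<^sup>2 \<partial>M))"
    using f g by (simp add: ennreal_power nn_integral_eq_integral ennreal_mult)
  finally have "(\<integral>x. f x \<bullet> g x \<partial>M)\<^sup>2 \<le> (\<integral>x. (norm (f x))\<^sup>2 \<partial>M) * (\<integral>x. (norm (g x))\<^sup>2 \<partial>M)"
    by (simp add: ennreal_power)
  then have "sqrt ((\<integral>x. f x \<bullet> g x \<partial>M)\<^sup>2) \<le> sqrt ((\<integral>x. (norm (f x))\<^sup>2 \<partial>M) * (\<integral>x. (norm (g x))\<^sup>2 \<partial>M))"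
    by (rule real_sqrt_le_mono)
  then show ?thesis by (simp add: real_sqrt_mult)
qed

lemma C1_compact_integrable:
  assumes "C1_compact f F" "C1_compact g H"
  shows "integrable lborel (\<lambda>x. F x $ i * g x)" "integrable lborel (\<lambda>x. f x * H x $ i)"
    "integrable lborel (\<lambda>x. (norm (F x))\<^sup>2)" "integrable lborel (\<lambda>x. (f x)\<^sup>2)"
proof -
  obtain R where cF: "continuous_on UNIV F" and R: "\<And>x. norm x > R \<Longrightarrow> f x = 0 \<and> F x = 0"
    using assms(1) unfolding C1_compact_def by blast
  have cH: "continuous_on UNIV H" using assms(2) unfolding C1_compact_def by blast
  note c = cF cH C1_compact_continuous[OF assms(1)] C1_compact_continuous[OF assms(2)]
  show "integrable lborel (\<lambda>x. F x $ i * g x)" "integrable lborel (\<lambda>x. f x * H x $ i)"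
    "integrable lborel (\<lambda>x. (norm (F x))\<^sup>2)" "integrable lborel (\<lambda>x. (f x)\<^sup>2)"
    by (rule integrable_continuous_compact_support[where R=R]; use R in \<open>auto intro!: continuous_intros c\<close>)+
qed

text \<open>The product \<open>f * g\<close> is again \<open>C1_compact\<close>, so the components
  of its gradient have integral zero.\<close>

lemma C1_compact_integration_by_parts:
  assumes "C1_compact f F" "C1_compact g H"
  shows "(\<integral>x. F x $ i * g x \<partial>lborel) = - (\<integral>x. f x * H x $ i \<partial>lborel)"
proof -
  note i = C1_compact_integrable(1,2)[OF assms, where i=i]
  obtain R where df: "\<And>x. (f has_derivative (\<lambda>h. F x \<bullet> h)) (at x)"
    and cF: "continuous_on UNIV F" and R: "\<And>x. norm x > R \<Longrightarrow> f x = 0 \<and> F x = 0"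
    using assms(1) unfolding C1_compact_def by blast
  have dg: "\<And>x. (g has_derivative (\<lambda>h. H x \<bullet> h)) (at x)" and cH: "continuous_on UNIV H"
    using assms(2) unfolding C1_compact_def by blast+
  note c = cF cH C1_compact_continuous[OF assms(1)] C1_compact_continuous[OF assms(2)]
  have "C1_compact (\<lambda>x. f x * g x) (\<lambda>x. g x *\<^sub>R F x + f x *\<^sub>R H x)"
    unfolding C1_compact_def
  proof (intro conjI allI exI[of _ R] impI)
    show "((\<lambda>x. f x * g x) has_derivative (\<lambda>h. (g x *\<^sub>R F x + f x *\<^sub>R H x) \<bullet> h)) (at x)" for x
      by (rule has_derivative_eq_rhs, rule has_derivative_mult[OF df dg])
         (auto simp: fun_eq_iff inner_add_left)
  qed (use R in \<open>auto intro!: continuous_intros c\<close>)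
  from C1_compact_integral_partial_eq_0[OF this, of i]
  have "(\<integral>x. F x $ i * g x + f x * H x $ i \<partial>lborel) = 0" by (simp add: mult.commute)
  then show ?thesis using i by simp
qed

section \<open>Linearity of \<open>H1V\<close> and uniqueness of the gradient\<close>

context coercive_potential
begin

text \<open>The combinations of two approximating sequences approximate the combination of their
  limits.\<close>

lemma H1V_pair_add_scaled:
  assumes "H1V_pair V u g" "H1V_pair V v h"
  shows "H1V_pair V (\<lambda>x. u x + t * v x) (\<lambda>x. g x + t *\<^sub>R h x)"
proof -
  obtain \<phi> G where \<phi>: "\<And>n. smooth_compact_support (\<phi> n)" "\<And>n x. (\<phi> n has_derivative (\<lambda>h. G n x \<bullet> h)) (at x)"
    "\<And>n. C1_compact (\<phi> n) (G n)"
    "(\<lambda>n. \<integral>\<^sup>+x. ennreal ((norm (G n x - g x))\<^sup>2) \<partial>lborel) \<longlonglongrightarrow> 0"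
    "(\<lambda>n. \<integral>\<^sup>+x. ennreal (V x * (\<phi> n x - u x)\<^sup>2) \<partial>lborel) \<longlonglongrightarrow> 0"
    by (rule H1V_pair_approx[OF assms(1)]) (rule that)
  obtain \<psi> H where \<psi>: "\<And>n. smooth_compact_support (\<psi> n)" "\<And>n x. (\<psi> n has_derivative (\<lambda>h. H n x \<bullet> h)) (at x)"
    "\<And>n. C1_compact (\<psi> n) (H n)"
    "(\<lambda>n. \<integral>\<^sup>+x. ennreal ((norm (H n x - h x))\<^sup>2) \<partial>lborel) \<longlonglongrightarrow> 0"
    "(\<lambda>n. \<integral>\<^sup>+x. ennreal (V x * (\<psi> n x - v x)\<^sup>2) \<partial>lborel) \<longlonglongrightarrow> 0"
    by (rule H1V_pair_approx[OF assms(2)]) (rule that)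
  note [measurable] = H1V_pair_measurable[OF assms(1)] H1V_pair_measurable[OF assms(2)]
    C1_compact_measurable[OF \<phi>(3)] C1_compact_measurable[OF \<psi>(3)]
  \<comment> \<open>An arbitrary weight and vector values cover both the gradients, with weight 1,
    and the functions, with weight \<open>V\<close>.\<close>
  have key: "(\<lambda>n. \<integral>\<^sup>+x. ennreal (w x * (norm ((A n x + t *\<^sub>R B n x) - (a x + t *\<^sub>R b x)))\<^sup>2) \<partial>lborel) \<longlonglongrightarrow> 0"
    if [measurable]: "\<And>n. A n \<in> borel_measurable borel" "\<And>n. B n \<in> borel_measurable borel"
        "a \<in> borel_measurable borel" "b \<in> borel_measurable borel" "w \<in> borel_measurable borel"
      and w: "\<And>x. w x \<ge> 0"
      and A: "(\<lambda>n. \<integral>\<^sup>+x. ennreal (w x * (norm (A n x - a x))\<^sup>2) \<partial>lborel) \<longlonglongrightarrow> 0"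
      and B: "(\<lambda>n. \<integral>\<^sup>+x. ennreal (w x * (norm (B n x - b x))\<^sup>2) \<partial>lborel) \<longlonglongrightarrow> 0"
    for A B :: "nat \<Rightarrow> R2 \<Rightarrow> 'e::euclidean_space" and a b and w :: "R2 \<Rightarrow> real"
  proof (rule tendsto_sandwich[OF always_eventually always_eventually tendsto_const])
    show "\<forall>n. (\<integral>\<^sup>+x. ennreal (w x * (norm ((A n x + t *\<^sub>R B n x) - (a x + t *\<^sub>R b x)))\<^sup>2) \<partial>lborel) \<le>
      2 * (\<integral>\<^sup>+x. ennreal (w x * (norm (A n x - a x))\<^sup>2) \<partial>lborel) + ennreal (2 * t\<^sup>2) * (\<integral>\<^sup>+x. ennreal (w x * (norm (B n x - b x))\<^sup>2) \<partial>lborel)"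
    proof
      fix n
      have "(\<integral>\<^sup>+x. ennreal (w x * (norm ((A n x - a x) + t *\<^sub>R (B n x - b x)))\<^sup>2) \<partial>lborel) \<le>
        2 * (\<integral>\<^sup>+x. ennreal (w x * (norm (A n x - a x))\<^sup>2) \<partial>lborel) + 2 * (\<integral>\<^sup>+x. ennreal (w x * (norm (t *\<^sub>R (B n x - b x)))\<^sup>2) \<partial>lborel)"
        by (rule nn_integral_weighted_square_add_le) (auto simp: w)
      also have "(\<integral>\<^sup>+x. ennreal (w x * (norm (t *\<^sub>R (B n x - b x)))\<^sup>2) \<partial>lborel) = (\<integral>\<^sup>+x. ennreal (t\<^sup>2) * ennreal (w x * (norm (B n x - b x))\<^sup>2) \<partial>lborel)"
        using w by (intro nn_integral_cong) (simp add: ennreal_mult[symmetric] power_mult_distrib mult_ac)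
      also have "\<dots> = ennreal (t\<^sup>2) * (\<integral>\<^sup>+x. ennreal (w x * (norm (B n x - b x))\<^sup>2) \<partial>lborel)"
        by (rule nn_integral_cmult) measurable
      finally show "(\<integral>\<^sup>+x. ennreal (w x * (norm ((A n x + t *\<^sub>R B n x) - (a x + t *\<^sub>R b x)))\<^sup>2) \<partial>lborel) \<le>
      2 * (\<integral>\<^sup>+x. ennreal (w x * (norm (A n x - a x))\<^sup>2) \<partial>lborel) + ennreal (2 * t\<^sup>2) * (\<integral>\<^sup>+x. ennreal (w x * (norm (B n x - b x))\<^sup>2) \<partial>lborel)"
        by (simp add: algebra_simps ennreal_mult mult.assoc)
    qed
    have "(\<lambda>n. 2 * (\<integral>\<^sup>+x. ennreal (w x * (norm (A n x - a x))\<^sup>2) \<partial>lborel) + ennreal (2 * t\<^sup>2) * (\<integral>\<^sup>+x. ennreal (w x * (norm (B n x - b x))\<^sup>2) \<partial>lborel)) \<longlonglongrightarrow> 2 * 0 + ennreal (2 * t\<^sup>2) * 0"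
      by (intro tendsto_add ennreal_tendsto_cmult A B) auto
    then show "(\<lambda>n. 2 * (\<integral>\<^sup>+x. ennreal (w x * (norm (A n x - a x))\<^sup>2) \<partial>lborel) + ennreal (2 * t\<^sup>2) * (\<integral>\<^sup>+x. ennreal (w x * (norm (B n x - b x))\<^sup>2) \<partial>lborel)) \<longlonglongrightarrow> 0"
      by simp
  qed auto
  show ?thesis unfolding H1V_pair_def
  proof (intro conjI exI[of _ "\<lambda>n x. \<phi> n x + t * \<psi> n x"] exI[of _ "\<lambda>n x. G n x + t *\<^sub>R H n x"] allI)
    show "smooth_compact_support (\<lambda>x. \<phi> n x + t * \<psi> n x)" for n
      by (rule smooth_compact_support_add_scaled[OF \<phi>(1) \<psi>(1)])
    show "((\<lambda>x. \<phi> n x + t * \<psi> n x) has_derivative (\<lambda>h. (G n x + t *\<^sub>R H n x) \<bullet> h)) (at x)" for n x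
      by (auto intro!: derivative_eq_intros \<phi>(2) \<psi>(2) simp: inner_add_left)
    show "(\<lambda>n. \<integral>\<^sup>+x. ennreal ((norm ((G n x + t *\<^sub>R H n x) - (g x + t *\<^sub>R h x)))\<^sup>2) \<partial>lborel) \<longlonglongrightarrow> 0"
      using key[of G H g h "\<lambda>_. 1"] \<phi>(4) \<psi>(4) by simp
    show "(\<lambda>n. \<integral>\<^sup>+x. ennreal (V x * ((\<phi> n x + t * \<psi> n x) - (u x + t * v x))\<^sup>2) \<partial>lborel) \<longlonglongrightarrow> 0"
      using key[of \<phi> \<psi> u v V] \<phi>(5) \<psi>(5) V_nonneg by simp
  qed measurable
qed

text \<open>This is closability of the gradient. As \<open>\<phi> n\<close> tends to 0, the limit
  \<open>w\<close> of the gradients is orthogonal to each \<open>G m\<close>, hence to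
  itself.\<close>

lemma H1V_pair_zero:
  assumes "H1V_pair V (\<lambda>x. 0) w"
  shows "AE x in lborel. w x = 0"
proof -
  obtain \<phi> G where \<phi>: "\<And>n. smooth_compact_support (\<phi> n)" "\<And>n x. (\<phi> n has_derivative (\<lambda>h. G n x \<bullet> h)) (at x)"
    "\<And>n. C1_compact (\<phi> n) (G n)"
    "\<And>n. (\<integral>\<^sup>+x. ennreal ((norm (G n x - w x))\<^sup>2) \<partial>lborel) \<le> 1"
    "\<And>n. (\<integral>\<^sup>+x. ennreal (V x * (\<phi> n x - 0)\<^sup>2) \<partial>lborel) \<le> 1"
    "(\<lambda>n. \<integral>\<^sup>+x. ennreal ((norm (G n x - w x))\<^sup>2) \<partial>lborel) \<longlonglongrightarrow> 0"
    "(\<lambda>n. \<integral>\<^sup>+x. ennreal (V x * (\<phi> n x - 0)\<^sup>2) \<partial>lborel) \<longlonglongrightarrow> 0"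
    by (rule H1V_pair_approx[OF assms]) (rule that)
  note [measurable] = H1V_pair_measurable[OF assms] C1_compact_measurable[OF \<phi>(3)]
  have w2: "integrable lborel (\<lambda>x. (norm (w x))\<^sup>2)" by (rule H1V_pair_square_integrable[OF assms])
  have G2: "integrable lborel (\<lambda>x. (norm (G n x))\<^sup>2)" and \<phi>2: "integrable lborel (\<lambda>x. (norm (\<phi> n x))\<^sup>2)" for n
    using C1_compact_integrable(3,4)[OF \<phi>(3) \<phi>(3)] by auto
  have d2: "integrable lborel (\<lambda>x. (norm (G n x - w x))\<^sup>2)" for n
    using order_le_less_trans[OF \<phi>(4)[of n]] by (auto simp: integrable_iff_bounded)
  define e where "e n = (\<integral>x. (norm (G n x - w x))\<^sup>2 \<partial>lborel)" for n
  define d where "d n = (\<integral>x. (norm (\<phi> n x))\<^sup>2 \<partial>lborel)" for n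
  have e: "e \<longlonglongrightarrow> 0"
  proof -
    have "(\<lambda>n. ennreal (e n)) \<longlonglongrightarrow> ennreal 0"
      using \<phi>(6) d2 by (simp add: e_def nn_integral_eq_integral)
    then show ?thesis using tendsto_ennreal_iff[of e sequentially 0] by (simp add: e_def)
  qed
  have d: "d \<longlonglongrightarrow> 0"
  proof -
    obtain c where c: "c > 0" "\<And>x. c \<le> V x" by (rule V_lower_bound) blast
    have Vi: "integrable lborel (\<lambda>x. V x * (\<phi> n x)\<^sup>2)" for n
      using C1_compact_nn_integral_finite(1)[OF \<phi>(3) V_cont V_nonneg, of n]
      by (auto simp: integrable_iff_bounded abs_mult V_nonneg)
    have "(\<lambda>n. ennreal (\<integral>x. V x * (\<phi> n x)\<^sup>2 \<partial>lborel)) \<longlonglongrightarrow> ennreal 0"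
      using \<phi>(7) Vi by (simp add: nn_integral_eq_integral V_nonneg)
    then have "(\<lambda>n. \<integral>x. V x * (\<phi> n x)\<^sup>2 \<partial>lborel) \<longlonglongrightarrow> 0"
      using tendsto_ennreal_iff[of "\<lambda>n. \<integral>x. V x * (\<phi> n x)\<^sup>2 \<partial>lborel" sequentially 0] by (simp add: V_nonneg)
    then have L: "(\<lambda>n. (\<integral>x. V x * (\<phi> n x)\<^sup>2 \<partial>lborel) / c) \<longlonglongrightarrow> 0" by (rule tendsto_divide_zero)
    have "d n \<le> (\<integral>x. V x * (\<phi> n x)\<^sup>2 \<partial>lborel) / c" for n
    proof -
      have "d n \<le> (\<integral>x. V x * (\<phi> n x)\<^sup>2 / c \<partial>lborel)"
        unfolding d_def using \<phi>2[of n] Vi[of n] c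
        by (intro integral_mono) (auto simp: field_simps intro!: mult_right_mono)
      then show ?thesis by simp
    qed
    then show ?thesis
      by (intro tendsto_sandwich[OF always_eventually always_eventually tendsto_const L]) (auto simp: d_def)
  qed
  \<comment> \<open>\<open>Q\<close> may depend on \<open>m\<close> but not on \<open>n\<close>:
    integration by parts moves the derivative from \<open>\<phi> n\<close> onto the fixed field
    \<open>G m\<close>.\<close>
  have GG: "\<exists>Q. \<forall>n. \<bar>\<integral>x. G n x \<bullet> G m x \<partial>lborel\<bar> \<le> sqrt (d n) * Q" for m
  proof -
    have "\<exists>H. \<forall>i. C1_compact (\<lambda>x. G m x $ i) (H i)"
      using smooth_compact_support_C1_compact(2)[OF \<phi>(1) \<phi>(2)] by (intro choice) blast
    then obtain H where H: "\<And>i. C1_compact (\<lambda>x. G m x $ i) (H i)" by blast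
    note [measurable] = C1_compact_measurable[OF H]
    have [measurable]: "(\<lambda>x. H i x $ j) \<in> borel_measurable borel" for i j
      unfolding cart_eq_inner_axis by measurable
    \<comment> \<open>The divergence of \<open>G m\<close>, that is, the Laplacian of
      \<open>\<phi> m\<close>.\<close>
    define D where "D x = H 1 x $ 1 + H 2 x $ 2" for x
    have H2: "integrable lborel (\<lambda>x. (H i x $ i)\<^sup>2)" for i
    proof (rule Bochner_Integration.integrable_bound)
      show "integrable lborel (\<lambda>x. (norm (H i x))\<^sup>2)" by (rule C1_compact_integrable(3)[OF H H])
      show "AE x in lborel. norm ((H i x $ i)\<^sup>2) \<le> norm ((norm (H i x))\<^sup>2)"
        using component_le_norm_cart[of "H i _" i] by (auto intro!: AE_I2 simp: abs_le_square_iff[symmetric])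
    qed measurable
    have D2: "integrable lborel (\<lambda>x. (norm (D x))\<^sup>2)"
    proof (rule Bochner_Integration.integrable_bound)
      show "integrable lborel (\<lambda>x. 2 * (H 1 x $ 1)\<^sup>2 + 2 * (H 2 x $ 2)\<^sup>2)" using H2 by simp
      have "(D x)\<^sup>2 \<le> 2 * (H 1 x $ 1)\<^sup>2 + 2 * (H 2 x $ 2)\<^sup>2" for x
        using sum_squares_bound[of "H 1 x $ 1" "H 2 x $ 2"] by (simp add: D_def power2_sum)
      then show "AE x in lborel. norm ((norm (D x))\<^sup>2) \<le> norm (2 * (H 1 x $ 1)\<^sup>2 + 2 * (H 2 x $ 2)\<^sup>2)"
        by (auto intro!: AE_I2)
    qed (simp add: D_def[abs_def])
    have "\<bar>\<integral>x. G n x \<bullet> G m x \<partial>lborel\<bar> \<le> sqrt (d n) * sqrt (\<integral>x. (norm (D x))\<^sup>2 \<partial>lborel)" for n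
    proof -
      have "(\<integral>x. G n x \<bullet> G m x \<partial>lborel) = (\<integral>x. G n x $ 1 * G m x $ 1 + G n x $ 2 * G m x $ 2 \<partial>lborel)"
        by (simp add: inner_vec_def UNIV_2)
      also have "\<dots> = (\<integral>x. G n x $ 1 * G m x $ 1 \<partial>lborel) + (\<integral>x. G n x $ 2 * G m x $ 2 \<partial>lborel)"
        by (intro Bochner_Integration.integral_add C1_compact_integrable(1)[OF \<phi>(3) H])
      also have "\<dots> = - ((\<integral>x. \<phi> n x * H 1 x $ 1 \<partial>lborel) + (\<integral>x. \<phi> n x * H 2 x $ 2 \<partial>lborel))"
        by (simp add: C1_compact_integration_by_parts[OF \<phi>(3) H])
      also have "\<dots> = - (\<integral>x. \<phi> n x * H 1 x $ 1 + \<phi> n x * H 2 x $ 2 \<partial>lborel)"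
        by (subst Bochner_Integration.integral_add) (auto intro!: C1_compact_integrable(2)[OF \<phi>(3) H])
      also have "\<dots> = - (\<integral>x. \<phi> n x \<bullet> D x \<partial>lborel)" by (simp add: D_def algebra_simps)
      finally have "\<bar>\<integral>x. G n x \<bullet> G m x \<partial>lborel\<bar> = \<bar>\<integral>x. \<phi> n x \<bullet> D x \<partial>lborel\<bar>" by simp
      also have "\<dots> \<le> sqrt (d n) * sqrt (\<integral>x. (norm (D x))\<^sup>2 \<partial>lborel)"
        unfolding d_def by (rule integral_inner_Cauchy_Schwarz[OF _ _ \<phi>2 D2]) (auto simp: D_def[abs_def])
      finally show ?thesis .
    qed
    then show ?thesis by blast
  qed
  \<comment> \<open>Here \<open>m\<close> is fixed and \<open>n\<close> tends to infinity. Replacing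
    \<open>w\<close> by \<open>G n\<close> costs \<open>sqrt (e n) * B\<close>, and the remaining
    pairing is at most \<open>sqrt (d n) * Q\<close>.\<close>
  have wG: "(\<integral>x. w x \<bullet> G m x \<partial>lborel) = 0" for m
  proof -
    obtain Q where Q: "\<And>n. \<bar>\<integral>x. G n x \<bullet> G m x \<partial>lborel\<bar> \<le> sqrt (d n) * Q" using GG by blast
    define B where "B = sqrt (\<integral>x. (norm (G m x))\<^sup>2 \<partial>lborel)"
    have "\<bar>\<integral>x. w x \<bullet> G m x \<partial>lborel\<bar> \<le> sqrt (e n) * B + sqrt (d n) * Q" for n
    proof -
      have i: "integrable lborel (\<lambda>x. (G n x - w x) \<bullet> G m x)" "integrable lborel (\<lambda>x. G n x \<bullet> G m x)"
        by (auto intro!: integrable_inner_of_square_integrable d2 G2)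
      have "(\<integral>x. w x \<bullet> G m x \<partial>lborel) = (\<integral>x. G n x \<bullet> G m x - (G n x - w x) \<bullet> G m x \<partial>lborel)"
        by (simp add: inner_diff_left)
      also have "\<dots> = (\<integral>x. G n x \<bullet> G m x \<partial>lborel) - (\<integral>x. (G n x - w x) \<bullet> G m x \<partial>lborel)"
        by (rule Bochner_Integration.integral_diff[OF i(2,1)])
      finally have "(\<integral>x. w x \<bullet> G m x \<partial>lborel) = (\<integral>x. G n x \<bullet> G m x \<partial>lborel) - (\<integral>x. (G n x - w x) \<bullet> G m x \<partial>lborel)" .
      moreover have "\<bar>\<integral>x. (G n x - w x) \<bullet> G m x \<partial>lborel\<bar> \<le> sqrt (e n) * B"
        unfolding e_def B_def by (rule integral_inner_Cauchy_Schwarz[OF _ _ d2 G2]) measurable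
      ultimately show ?thesis using Q[of n] by linarith
    qed
    moreover have "(\<lambda>n. sqrt (e n) * B + sqrt (d n) * Q) \<longlonglongrightarrow> sqrt 0 * B + sqrt 0 * Q"
      by (intro tendsto_intros e d)
    ultimately have "\<bar>\<integral>x. w x \<bullet> G m x \<partial>lborel\<bar> \<le> sqrt 0 * B + sqrt 0 * Q"
      by (intro LIMSEQ_le_const) auto
    then show ?thesis by simp
  qed
  \<comment> \<open>Orthogonality to \<open>G m\<close> leaves only the pairing of
    \<open>G m - w\<close> with \<open>w\<close>; now \<open>m\<close> tends to infinity.\<close>
  have "(\<integral>x. (norm (w x))\<^sup>2 \<partial>lborel) \<le> sqrt (e m) * sqrt (\<integral>x. (norm (w x))\<^sup>2 \<partial>lborel)" for m
  proof -
    have i: "integrable lborel (\<lambda>x. w x \<bullet> G m x)" "integrable lborel (\<lambda>x. (G m x - w x) \<bullet> w x)"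
      by (auto intro!: integrable_inner_of_square_integrable d2 G2 w2)
    have "(\<integral>x. (norm (w x))\<^sup>2 \<partial>lborel) = (\<integral>x. w x \<bullet> G m x - (G m x - w x) \<bullet> w x \<partial>lborel)"
      by (simp add: inner_diff_left inner_diff_right power2_norm_eq_inner inner_commute)
    also have "\<dots> = - (\<integral>x. (G m x - w x) \<bullet> w x \<partial>lborel)"
      using i wG by simp
    also have "\<dots> \<le> \<bar>\<integral>x. (G m x - w x) \<bullet> w x \<partial>lborel\<bar>" by simp
    also have "\<dots> \<le> sqrt (e m) * sqrt (\<integral>x. (norm (w x))\<^sup>2 \<partial>lborel)"
      unfolding e_def by (rule integral_inner_Cauchy_Schwarz[OF _ _ d2 w2]) measurable
    finally show ?thesis .
  qed
  moreover have "(\<lambda>m. sqrt (e m) * sqrt (\<integral>x. (norm (w x))\<^sup>2 \<partial>lborel)) \<longlonglongrightarrow> sqrt 0 * sqrt (\<integral>x. (norm (w x))\<^sup>2 \<partial>lborel)"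
    by (intro tendsto_intros e)
  ultimately have "(\<integral>x. (norm (w x))\<^sup>2 \<partial>lborel) \<le> sqrt 0 * sqrt (\<integral>x. (norm (w x))\<^sup>2 \<partial>lborel)"
    by (intro LIMSEQ_le_const) auto
  moreover have "(\<integral>x. (norm (w x))\<^sup>2 \<partial>lborel) \<ge> 0" by (simp add: integral_nonneg)
  ultimately have "(\<integral>x. (norm (w x))\<^sup>2 \<partial>lborel) = 0" by simp
  then show ?thesis
    using integral_nonneg_eq_0_iff_AE[OF w2] by simp
qed

text \<open>The difference of the two pairs is a pair over the zero function. Hence the choice made
  in \<open>grad\<close> is immaterial up to null sets.\<close>

lemma H1V_pair_unique:
  assumes "H1V_pair V u g" "H1V_pair V u h"
  shows "AE x in lborel. g x = h x"
  using H1V_pair_zero[of "\<lambda>x. g x + (-1) *\<^sub>R h x"] H1V_pair_add_scaled[OF assms, of "-1"] by simp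

lemma H1V_grad:
  assumes "u \<in> H1V V"
  shows "H1V_pair V u (grad V u)"
proof -
  have "\<exists>g. H1V_pair V u g" using assms by (simp add: H1V_def)
  then show ?thesis unfolding grad_def by (rule someI_ex)
qed

lemma H1V_add_scaled:
  assumes "u \<in> H1V V" "v \<in> H1V V"
  shows "(\<lambda>x. u x + t * v x) \<in> H1V V"
  using H1V_pair_add_scaled[OF H1V_grad[OF assms(1)] H1V_grad[OF assms(2)], of t] unfolding H1V_def by auto

lemma grad_add_scaled:
  assumes "u \<in> H1V V" "v \<in> H1V V"
  shows "AE x in lborel. grad V (\<lambda>x. u x + t * v x) x = grad V u x + t *\<^sub>R grad V v x"
  by (rule H1V_pair_unique[OF H1V_grad[OF H1V_add_scaled[OF assms]] H1V_pair_add_scaled[OF H1V_grad[OF assms(1)] H1V_grad[OF assms(2)]]])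

end

section \<open>Differentiation of weighted powers under the integral\<close>

text \<open>Away from 0 this is the chain rule. At 0 the difference quotient has modulus
  \<open>\<bar>h\<bar> powr (q - 1)\<close>, which tends to 0 because \<open>q > 1\<close>, and
  \<open>sgn 0 = 0\<close> makes the formula agree.\<close>

lemma DERIV_abs_powr:
  fixes q s :: real
  assumes "q > 1"
  shows "((\<lambda>s. \<bar>s\<bar> powr q) has_real_derivative q * \<bar>s\<bar> powr (q - 1) * sgn s) (at s)"
proof (cases "s = 0")
  case True
  have "((\<lambda>h::real. \<bar>\<bar>h\<bar> powr q / h\<bar>) \<longlongrightarrow> 0) (at 0)"
  proof (rule Lim_transform_eventually)
    have "((\<lambda>h::real. \<bar>h\<bar> powr (q - 1)) \<longlongrightarrow> \<bar>0\<bar> powr (q - 1)) (at 0)"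
      by (rule tendsto_powr2) (use assms in \<open>auto intro!: tendsto_eq_intros\<close>)
    then show "((\<lambda>h::real. \<bar>h\<bar> powr (q - 1)) \<longlongrightarrow> 0) (at 0)" by simp
    show "\<forall>\<^sub>F h in at (0::real). \<bar>h\<bar> powr (q - 1) = \<bar>\<bar>h\<bar> powr q / h\<bar>"
      unfolding eventually_at_filter by (rule always_eventually) (auto simp: abs_divide powr_diff)
  qed
  then have "((\<lambda>h::real. \<bar>h\<bar> powr q / h) \<longlongrightarrow> 0) (at 0)" by (simp only: tendsto_rabs_zero_iff)
  then show ?thesis using True by (simp add: DERIV_def)
next
  case False
  have "((\<lambda>s. \<bar>s\<bar> powr q) has_real_derivative (q * \<bar>s\<bar> powr (q - 1)) * sgn s) (at s)"
  proof (rule DERIV_chain2[where f="\<lambda>r. r powr q" and g=abs])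
    show "(abs has_real_derivative sgn s) (at s)"
    proof (cases "s > 0")
      case True
      have "(abs has_real_derivative 1) (at s)"
        by (rule has_field_derivative_transform_within_open[OF DERIV_ident, of "{0<..}"]) (use True in auto)
      then show ?thesis using True by simp
    next
      case F: False
      have "(abs has_real_derivative -1) (at s)"
        by (rule has_field_derivative_transform_within_open[OF DERIV_minus[OF DERIV_ident], of "{..<0}"])
           (use F False in auto)
      then show ?thesis using F False by simp
    qed
  qed (use False in \<open>auto intro!: derivative_eq_intros\<close>)
  then show ?thesis .
qed

text \<open>The mean value theorem on \<open>{-R..R}\<close> with
  \<open>R = \<bar>a\<bar> + \<bar>b\<bar>\<close>; \<open>\<bar>t\<bar> \<le> 1\<close> keeps both
  points inside. Divided by \<open>\<bar>t\<bar>\<close> the bound is independent of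
  \<open>t\<close> and can dominate difference quotients.\<close>

lemma abs_powr_diff_le:
  fixes q a b t :: real
  assumes "q > 1" "\<bar>t\<bar> \<le> 1"
  shows "\<bar>\<bar>a + t * b\<bar> powr q - \<bar>a\<bar> powr q\<bar> \<le> q * (\<bar>a\<bar> + \<bar>b\<bar>) powr q * \<bar>t\<bar>"
proof -
  define R where "R = \<bar>a\<bar> + \<bar>b\<bar>"
  have R: "R \<ge> 0" by (simp add: R_def)
  have tb: "\<bar>t * b\<bar> \<le> \<bar>b\<bar>" using assms(2) by (simp add: abs_mult mult_left_le_one_le)
  have "norm (\<bar>a + t * b\<bar> powr q - \<bar>a\<bar> powr q) \<le> (q * R powr (q - 1)) * norm ((a + t * b) - a)"
  proof (rule field_differentiable_bound[where S="{-R..R}" and f'="\<lambda>s. q * \<bar>s\<bar> powr (q - 1) * sgn s"])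
    fix s assume "s \<in> {-R..R}"
    then have "\<bar>s\<bar> powr (q - 1) \<le> R powr (q - 1)" using assms by (intro powr_mono2) auto
    then show "norm (q * \<bar>s\<bar> powr (q - 1) * sgn s) \<le> q * R powr (q - 1)"
      using assms by (auto simp: abs_mult sgn_if)
  qed (use tb in \<open>auto simp: R_def intro!: has_field_derivative_at_within[OF DERIV_abs_powr[OF assms(1)]]\<close>)
  also have "\<dots> = (q * R powr (q - 1)) * (\<bar>t\<bar> * \<bar>b\<bar>)" by (simp add: abs_mult)
  \<comment> \<open>Enlarging \<open>\<bar>b\<bar>\<close> to \<open>R\<close> restores the full
    exponent \<open>q\<close>, so that integrability of one weighted power is enough.\<close>
  also have "\<dots> \<le> (q * R powr (q - 1)) * (\<bar>t\<bar> * R)"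
    using assms by (intro mult_left_mono) (auto simp: R_def)
  also have "\<dots> = q * (R powr (q - 1) * R powr 1) * \<bar>t\<bar>" using R by (simp add: mult_ac)
  also have "R powr (q - 1) * R powr 1 = R powr q" by (simp only: powr_add[symmetric]) simp
  finally show ?thesis by (simp add: R_def)
qed

text \<open>Dominated convergence for the difference quotients along sequences tending to 0; the
  same argument shows that their limit is integrable.\<close>

lemma has_real_derivative_integral_abs_powr:
  fixes V u v :: "'a \<Rightarrow> real"
  assumes [measurable]: "V \<in> borel_measurable M" "u \<in> borel_measurable M" "v \<in> borel_measurable M"
    and V: "\<And>x. V x \<ge> 0" and q: "q > 1"
    and dom: "integrable M (\<lambda>x. V x * (\<bar>u x\<bar> + \<bar>v x\<bar>) powr q)"
    and int: "\<And>t. integrable M (\<lambda>x. V x * \<bar>u x + t * v x\<bar> powr q)"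
  shows "((\<lambda>t. \<integral>x. V x * \<bar>u x + t * v x\<bar> powr q \<partial>M) has_real_derivative
    (\<integral>x. V x * (q * \<bar>u x\<bar> powr (q - 1) * sgn (u x) * v x) \<partial>M)) (at 0)" (is "(?F has_real_derivative ?D) _")
    and "integrable M (\<lambda>x. V x * (q * \<bar>u x\<bar> powr (q - 1) * sgn (u x) * v x))"
proof -
  \<comment> \<open>Terms of modulus at most 1 are required by \<open>abs_powr_diff_le\<close>; a
    general null sequence of nonzero terms satisfies this after a shift.\<close>
  have key: "integrable M (\<lambda>x. V x * (q * \<bar>u x\<bar> powr (q - 1) * sgn (u x) * v x)) \<and>
     (\<lambda>n. (?F (X n) - ?F 0) / X n) \<longlonglongrightarrow> ?D"
    if X: "\<And>n. X n \<noteq> 0" "\<And>n. \<bar>X n\<bar> \<le> 1" and X0: "X \<longlonglongrightarrow> 0" for X :: "nat \<Rightarrow> real"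
  proof -
    define s where "s n x = V x * (\<bar>u x + X n * v x\<bar> powr q - \<bar>u x\<bar> powr q) / X n" for n x
    define w where "w x = q * (V x * (\<bar>u x\<bar> + \<bar>v x\<bar>) powr q)" for x
    have sm: "\<And>n. s n \<in> borel_measurable M" unfolding s_def[abs_def] by measurable
    have wi: "integrable M w" unfolding w_def[abs_def] using dom by simp
    have le: "AE x in M. norm (s n x) \<le> w x" for n
    proof (rule AE_I2)
      fix x
      have "norm (s n x) = V x * \<bar>\<bar>u x + X n * v x\<bar> powr q - \<bar>u x\<bar> powr q\<bar> / \<bar>X n\<bar>"
        using V[of x] by (simp add: s_def abs_mult)
      also have "\<dots> \<le> V x * (q * (\<bar>u x\<bar> + \<bar>v x\<bar>) powr q * \<bar>X n\<bar>) / \<bar>X n\<bar>"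
        by (intro divide_right_mono mult_left_mono abs_powr_diff_le q X V) auto
      also have "\<dots> = w x" using X(1)[of n] by (simp add: w_def)
      finally show "norm (s n x) \<le> w x" .
    qed
    have lim: "AE x in M. (\<lambda>n. s n x) \<longlonglongrightarrow> V x * (q * \<bar>u x\<bar> powr (q - 1) * sgn (u x) * v x)"
    proof (rule AE_I2)
      fix x
      have "((\<lambda>t. \<bar>u x + t * v x\<bar> powr q) has_real_derivative (q * \<bar>u x\<bar> powr (q - 1) * sgn (u x)) * v x) (at 0)"
        by (rule DERIV_chain2[where f="\<lambda>s. \<bar>s\<bar> powr q" and g="\<lambda>t. u x + t * v x"])
           (use DERIV_abs_powr[OF q, of "u x"] in \<open>auto intro!: derivative_eq_intros\<close>)
      then have L: "((\<lambda>t. (\<bar>u x + t * v x\<bar> powr q - \<bar>u x\<bar> powr q) / t) \<longlongrightarrow> q * \<bar>u x\<bar> powr (q - 1) * sgn (u x) * v x) (at 0)"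
        by (simp add: DERIV_def)
      have "filterlim X (at 0) sequentially" using X0 X(1) by (auto simp: filterlim_at)
      from tendsto_mult[OF tendsto_const[of "V x"] filterlim_compose[OF L this]]
      show "(\<lambda>n. s n x) \<longlonglongrightarrow> V x * (q * \<bar>u x\<bar> powr (q - 1) * sgn (u x) * v x)"
        by (simp add: s_def)
    qed
    have "(\<lambda>n. integral\<^sup>L M (s n)) \<longlonglongrightarrow> ?D"
      by (rule integral_dominated_convergence[OF _ sm wi lim le]) measurable
    moreover have "integral\<^sup>L M (s n) = (?F (X n) - ?F 0) / X n" for n
    proof -
      have "integral\<^sup>L M (s n) = (\<integral>x. (V x * \<bar>u x + X n * v x\<bar> powr q - V x * \<bar>u x + 0 * v x\<bar> powr q) / X n \<partial>M)"
        by (simp add: s_def[abs_def] algebra_simps)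
      also have "\<dots> = (?F (X n) - ?F 0) / X n"
        using int[of "X n"] int[of 0] by simp
      finally show ?thesis .
    qed
    moreover have "integrable M (\<lambda>x. V x * (q * \<bar>u x\<bar> powr (q - 1) * sgn (u x) * v x))"
      by (rule integrable_dominated_convergence[OF _ sm wi lim le]) measurable
    ultimately show ?thesis by simp
  qed
  show "integrable M (\<lambda>x. V x * (q * \<bar>u x\<bar> powr (q - 1) * sgn (u x) * v x))"
    using key[of "\<lambda>n. inverse (real (Suc n))"] LIMSEQ_inverse_real_of_nat by (auto simp: inverse_le_1_iff)
  have "((\<lambda>t. (?F t - ?F 0) / t) \<longlongrightarrow> ?D) (at 0)"
    unfolding tendsto_at_iff_sequentially
  proof (intro allI impI)
    fix X :: "nat \<Rightarrow> real" assume X: "\<forall>i. X i \<in> UNIV - {0}" and X0: "X \<longlonglongrightarrow> 0"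
    have "eventually (\<lambda>n. \<bar>X n\<bar> < 1) sequentially"
      using order_tendstoD(2)[OF tendsto_rabs_zero[OF X0], of 1] by simp
    then obtain N where N: "\<And>n. n \<ge> N \<Longrightarrow> \<bar>X n\<bar> < 1" by (auto simp: eventually_sequentially)
    have "(\<lambda>n. (?F (X (n + N)) - ?F 0) / X (n + N)) \<longlonglongrightarrow> ?D"
      using key[of "\<lambda>n. X (n + N)"] X N LIMSEQ_ignore_initial_segment[OF X0, of N] by (auto simp: less_imp_le)
    then have "(\<lambda>n. (?F (X n) - ?F 0) / X n) \<longlonglongrightarrow> ?D" by (rule LIMSEQ_offset)
    then show "((\<lambda>t. (?F t - ?F 0) / t) \<circ> X) \<longlonglongrightarrow> ?D" by (simp add: comp_def)
  qed
  then show "(?F has_real_derivative ?D) (at 0)" by (simp add: DERIV_def)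
qed

section \<open>The functionals and their directional derivatives\<close>

context coercive_potential
begin

text \<open>Interpolation between exponent 2 and an even integer exponent above \<open>q\<close>:
  the former controls small values of \<open>\<bar>u x\<bar>\<close>, the latter large ones.\<close>

lemma H1V_powr_integrable:
  assumes "u \<in> H1V V" "q \<ge> 2"
  shows "integrable lborel (\<lambda>x. V x * \<bar>u x\<bar> powr q)"
proof -
  note P = H1V_grad[OF assms(1)]
  note [measurable] = H1V_pair_measurable[OF P]
  define j where "j = nat \<lceil>q\<rceil>"
  have j: "q \<le> real (2 * Suc j)" using real_nat_ceiling_ge[of q] by (simp add: j_def)
  show ?thesis
  proof (rule Bochner_Integration.integrable_bound)
    show "integrable lborel (\<lambda>x. V x * (u x)\<^sup>2 + V x * \<bar>u x\<bar> ^ (2 * Suc j))"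
      by (intro Bochner_Integration.integrable_add H1V_pair_power_integrable[OF P] H1V_pair_square_integrable(2)[OF P])
    have "\<bar>u x\<bar> powr q \<le> (u x)\<^sup>2 + \<bar>u x\<bar> ^ (2 * Suc j)" for x
    proof (cases "u x = 0")
      case False
      show ?thesis
      proof (cases "\<bar>u x\<bar> \<le> 1")
        case True
        then have "\<bar>u x\<bar> powr q \<le> \<bar>u x\<bar> powr real 2"
          using False assms by (intro powr_mono') auto
        also have "\<dots> = (u x)\<^sup>2" using False by (subst powr_realpow) auto
        finally show ?thesis by (smt (verit) zero_le_power abs_ge_zero)
      next
        case F: False
        then have "\<bar>u x\<bar> powr q \<le> \<bar>u x\<bar> powr real (2 * Suc j)"
          using j by (intro powr_mono) auto
        also have "\<dots> = \<bar>u x\<bar> ^ (2 * Suc j)" using False by (subst powr_realpow) auto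
        finally show ?thesis by (smt (verit) zero_le_power2)
      qed
    qed simp
    then have "V x * \<bar>u x\<bar> powr q \<le> V x * (u x)\<^sup>2 + V x * \<bar>u x\<bar> ^ (2 * Suc j)" for x
      using mult_left_mono[OF _ V_nonneg[of x]] by (simp only: distrib_left[symmetric])
    then show "AE x in lborel. norm (V x * \<bar>u x\<bar> powr q) \<le> norm (V x * (u x)\<^sup>2 + V x * \<bar>u x\<bar> ^ (2 * Suc j))"
      using V_nonneg by (intro AE_I2) (smt (verit) mult_nonneg_nonneg powr_ge_zero real_norm_def)
  qed measurable
qed

text \<open>Pointwise, \<open>\<bar>u x\<bar> + \<bar>v x\<bar>\<close> equals
  \<open>\<bar>u x + v x\<bar>\<close> or \<open>\<bar>u x - v x\<bar>\<close>, and both functions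
  lie in \<open>H1V V\<close>. This provides the domination for differentiating under the
  integral.\<close>

lemma H1V_powr_sum_integrable:
  assumes "u \<in> H1V V" "v \<in> H1V V" "q \<ge> 2"
  shows "integrable lborel (\<lambda>x. V x * (\<bar>u x\<bar> + \<bar>v x\<bar>) powr q)"
proof (rule Bochner_Integration.integrable_bound)
  note [measurable] = H1V_pair_measurable[OF H1V_grad[OF assms(1)]] H1V_pair_measurable[OF H1V_grad[OF assms(2)]]
  show "integrable lborel (\<lambda>x. V x * \<bar>u x + 1 * v x\<bar> powr q + V x * \<bar>u x + (-1) * v x\<bar> powr q)"
    by (intro Bochner_Integration.integrable_add H1V_powr_integrable H1V_add_scaled assms)
  have "(\<bar>u x\<bar> + \<bar>v x\<bar>) powr q \<le> \<bar>u x + 1 * v x\<bar> powr q + \<bar>u x + (-1) * v x\<bar> powr q" for x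
  proof -
    have "\<bar>u x\<bar> + \<bar>v x\<bar> = \<bar>u x + 1 * v x\<bar> \<or> \<bar>u x\<bar> + \<bar>v x\<bar> = \<bar>u x + (-1) * v x\<bar>" by linarith
    then show ?thesis by (elim disjE) simp_all
  qed
  then have "V x * (\<bar>u x\<bar> + \<bar>v x\<bar>) powr q \<le> V x * \<bar>u x + 1 * v x\<bar> powr q + V x * \<bar>u x + (-1) * v x\<bar> powr q" for x
    using mult_left_mono[OF _ V_nonneg[of x]] by (simp only: distrib_left[symmetric])
  then show "AE x in lborel. norm (V x * (\<bar>u x\<bar> + \<bar>v x\<bar>) powr q) \<le> norm (V x * \<bar>u x + 1 * v x\<bar> powr q + V x * \<bar>u x + (-1) * v x\<bar> powr q)"
    using V_nonneg by (intro AE_I2) (smt (verit) mult_nonneg_nonneg powr_ge_zero real_norm_def)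
  show "(\<lambda>x. V x * (\<bar>u x\<bar> + \<bar>v x\<bar>) powr q) \<in> borel_measurable lborel" by measurable
qed

definition inner_V :: "(R2 \<Rightarrow> real) \<Rightarrow> (R2 \<Rightarrow> real) \<Rightarrow> real" where
  "inner_V u v = (\<integral>x. grad V u x \<bullet> grad V v x + V x * (u x * v x) \<partial>lborel)"

lemma H1V_integrable_products:
  assumes "u \<in> H1V V" "v \<in> H1V V"
  shows "integrable lborel (\<lambda>x. grad V u x \<bullet> grad V v x)" "integrable lborel (\<lambda>x. V x * (u x * v x))"
    "integrable lborel (\<lambda>x. u x * v x)"
proof -
  note P = H1V_grad[OF assms(1)] H1V_grad[OF assms(2)]
  note [measurable] = H1V_pair_measurable[OF P(1)] H1V_pair_measurable[OF P(2)]
  note S = H1V_pair_square_integrable[OF P(1)] H1V_pair_square_integrable[OF P(2)]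
  show "integrable lborel (\<lambda>x. grad V u x \<bullet> grad V v x)"
    by (rule integrable_inner_of_square_integrable) (use S in auto)
  show "integrable lborel (\<lambda>x. u x * v x)"
    using integrable_inner_of_square_integrable[of u lborel v] S by simp
  \<comment> \<open>Splitting the weight as \<open>sqrt (V x)\<close> on each factor reduces the
    claim to the unweighted one.\<close>
  have "integrable lborel (\<lambda>x. (sqrt (V x) * u x) \<bullet> (sqrt (V x) * v x))"
    by (rule integrable_inner_of_square_integrable) (use S V_nonneg in \<open>auto simp: power_mult_distrib\<close>)
  moreover have "(sqrt (V x) * u x) \<bullet> (sqrt (V x) * v x) = V x * (u x * v x)" for x
    using V_nonneg[of x] by (simp add: power2_eq_square[symmetric] mult.assoc mult.left_commute[of "u x"])
  ultimately show "integrable lborel (\<lambda>x. V x * (u x * v x))" by (simp only:)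
qed

text \<open>Additivity of \<open>grad\<close> holds only almost everywhere, so the integrands are
  compared by \<open>integral_cong_AE\<close>.\<close>

lemma inner_V_add_scaled:
  assumes "u \<in> H1V V" "v \<in> H1V V" "z \<in> H1V V"
  shows "inner_V z (\<lambda>x. u x + t * v x) = inner_V z u + t * inner_V z v"
proof -
  have [measurable]: "grad V z \<in> borel_measurable borel" "z \<in> borel_measurable borel"
    "grad V u \<in> borel_measurable borel" "u \<in> borel_measurable borel"
    "grad V v \<in> borel_measurable borel" "v \<in> borel_measurable borel"
    "grad V (\<lambda>x. u x + t * v x) \<in> borel_measurable borel" for t
    using H1V_pair_measurable[OF H1V_grad] H1V_add_scaled assms by auto
  have "inner_V z (\<lambda>x. u x + t * v x) = (\<integral>x. (grad V z x \<bullet> grad V u x + V x * (z x * u x)) + t * (grad V z x \<bullet> grad V v x + V x * (z x * v x)) \<partial>lborel)"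
    unfolding inner_V_def
    by (rule integral_cong_AE) (use grad_add_scaled[OF assms(1,2), of t] in \<open>auto simp: inner_add_right algebra_simps\<close>)
  also have "\<dots> = inner_V z u + t * inner_V z v"
    unfolding inner_V_def using H1V_integrable_products[OF assms(3,1)] H1V_integrable_products[OF assms(3,2)] by simp
  finally show ?thesis .
qed

lemma inner_V_commute: "inner_V u v = inner_V v u"
  unfolding inner_V_def by (simp add: inner_commute mult.commute)

lemma normVsq_eq_inner_V: "normVsq V u = inner_V u u"
  unfolding inner_V_def normVsq_def by (simp add: power2_norm_eq_inner) (simp add: power2_eq_square)

lemma normVsq_add_scaled:
  assumes "u \<in> H1V V" "v \<in> H1V V"
  shows "normVsq V (\<lambda>x. u x + t * v x) = normVsq V u + 2 * t * inner_V u v + t\<^sup>2 * normVsq V v"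
proof -
  note H = H1V_add_scaled[OF assms, of t]
  show ?thesis
    unfolding normVsq_eq_inner_V inner_V_add_scaled[OF assms H]
    unfolding inner_V_commute[of "\<lambda>x. u x + t * v x"]
    by (simp add: inner_V_add_scaled assms inner_V_commute[of v u] power2_eq_square algebra_simps)
qed

lemma L2sq_add_scaled:
  assumes "u \<in> H1V V" "v \<in> H1V V"
  shows "L2sq (\<lambda>x. u x + t * v x) = L2sq u + 2 * t * (\<integral>x. u x * v x \<partial>lborel) + t\<^sup>2 * L2sq v"
proof -
  have "L2sq (\<lambda>x. u x + t * v x) = (\<integral>x. (u x * u x + (2 * t) * (u x * v x)) + t\<^sup>2 * (v x * v x) \<partial>lborel)"
    unfolding L2sq_def by (rule Bochner_Integration.integral_cong) (auto simp: power2_eq_square algebra_simps)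
  also have "\<dots> = (\<integral>x. u x * u x \<partial>lborel) + 2 * t * (\<integral>x. u x * v x \<partial>lborel) + t\<^sup>2 * (\<integral>x. v x * v x \<partial>lborel)"
    using H1V_integrable_products(3)[OF assms] H1V_integrable_products(3)[OF assms(1,1)] H1V_integrable_products(3)[OF assms(2,2)] by simp
  finally show ?thesis by (simp add: L2sq_def power2_eq_square)
qed

text \<open>A vanishing norm makes \<open>V x * (u x)^2\<close> vanish almost everywhere, and
  \<open>V\<close> is positive. On the Nehari set this makes the derivative of \<open>J\<close> at
  \<open>u\<close> in direction \<open>u\<close> nonzero.\<close>

lemma normVsq_pos:
  assumes "u \<in> H1V V" "\<not> (AE x in lborel. u x = 0)"
  shows "normVsq V u > 0"
proof -
  note S = H1V_pair_square_integrable[OF H1V_grad[OF assms(1)]]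
  have i: "integrable lborel (\<lambda>x. (norm (grad V u x))\<^sup>2 + V x * (u x)\<^sup>2)" using S by simp
  have n: "AE x in lborel. 0 \<le> (norm (grad V u x))\<^sup>2 + V x * (u x)\<^sup>2" by (simp add: V_nonneg)
  have "normVsq V u \<noteq> 0"
  proof
    assume "normVsq V u = 0"
    then have "AE x in lborel. (norm (grad V u x))\<^sup>2 + V x * (u x)\<^sup>2 = 0"
      using integral_nonneg_eq_0_iff_AE[OF i n] by (simp add: normVsq_def)
    then have "AE x in lborel. u x = 0"
    proof eventually_elim
      case (elim x)
      then have "V x * (u x)\<^sup>2 = 0" using V_nonneg[of x] by (simp add: add_nonneg_eq_0_iff)
      then show ?case using V_pos[of x] by simp
    qed
    with assms(2) show False by simp
  qed
  moreover have "normVsq V u \<ge> 0" unfolding normVsq_def by (rule integral_nonneg_AE[OF n])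
  ultimately show ?thesis by simp
qed

definition powr_integral :: "real \<Rightarrow> (R2 \<Rightarrow> real) \<Rightarrow> real" where
  "powr_integral q u = (\<integral>x. V x * \<bar>u x\<bar> powr q \<partial>lborel)"

text \<open>The factor \<open>\<bar>u x\<bar> powr (q - 1) * sgn (u x)\<close> is the familiar
  \<open>|u|^(q-2) u\<close>, written so that it makes sense at zeros of \<open>u\<close>.\<close>

definition powr_integral_deriv :: "real \<Rightarrow> (R2 \<Rightarrow> real) \<Rightarrow> (R2 \<Rightarrow> real) \<Rightarrow> real" where
  "powr_integral_deriv q u v = (\<integral>x. V x * (q * \<bar>u x\<bar> powr (q - 1) * sgn (u x) * v x) \<partial>lborel)"

text \<open>The product rule for the nonlocal term
  \<open>L2sq u * powr_integral q u\<close>.\<close>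

definition nonlocal_deriv :: "real \<Rightarrow> (R2 \<Rightarrow> real) \<Rightarrow> (R2 \<Rightarrow> real) \<Rightarrow> real" where
  "nonlocal_deriv q u v = 2 * (\<integral>x. u x * v x \<partial>lborel) * powr_integral q u + L2sq u * powr_integral_deriv q u v"

lemma has_real_derivative_powr_integral:
  assumes "u \<in> H1V V" "v \<in> H1V V" "q \<ge> 2"
  shows "((\<lambda>t. powr_integral q (\<lambda>x. u x + t * v x)) has_real_derivative powr_integral_deriv q u v) (at 0)"
    and "integrable lborel (\<lambda>x. V x * (q * \<bar>u x\<bar> powr (q - 1) * sgn (u x) * v x))"
proof -
  note [measurable] = H1V_pair_measurable[OF H1V_grad[OF assms(1)]] H1V_pair_measurable[OF H1V_grad[OF assms(2)]]
  have m: "V \<in> borel_measurable lborel" "u \<in> borel_measurable lborel" "v \<in> borel_measurable lborel" by measurable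
  note * = has_real_derivative_integral_abs_powr[OF m V_nonneg _ H1V_powr_sum_integrable[OF assms] H1V_powr_integrable[OF H1V_add_scaled[OF assms(1,2)] assms(3)]]
  show "((\<lambda>t. powr_integral q (\<lambda>x. u x + t * v x)) has_real_derivative powr_integral_deriv q u v) (at 0)"
    and "integrable lborel (\<lambda>x. V x * (q * \<bar>u x\<bar> powr (q - 1) * sgn (u x) * v x))"
    using * assms(3) by (simp_all add: powr_integral_def powr_integral_deriv_def)
qed

lemma nonlocal_deriv_add_scaled:
  assumes "u \<in> H1V V" "v \<in> H1V V" "z \<in> H1V V" "q \<ge> 2"
  shows "nonlocal_deriv q z (\<lambda>x. u x + t * v x) = nonlocal_deriv q z u + t * nonlocal_deriv q z v"
proof -
  have "powr_integral_deriv q z (\<lambda>x. u x + t * v x) = (\<integral>x. V x * (q * \<bar>z x\<bar> powr (q - 1) * sgn (z x) * u x) + t * (V x * (q * \<bar>z x\<bar> powr (q - 1) * sgn (z x) * v x)) \<partial>lborel)"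
    unfolding powr_integral_deriv_def by (rule Bochner_Integration.integral_cong) (simp_all only: distrib_left distrib_right mult_ac)
  also have "\<dots> = powr_integral_deriv q z u + t * powr_integral_deriv q z v"
    unfolding powr_integral_deriv_def using has_real_derivative_powr_integral(2)[OF assms(3,1,4)] has_real_derivative_powr_integral(2)[OF assms(3,2,4)] by simp
  finally have 1: "powr_integral_deriv q z (\<lambda>x. u x + t * v x) = powr_integral_deriv q z u + t * powr_integral_deriv q z v" .
  have "(\<integral>x. z x * (u x + t * v x) \<partial>lborel) = (\<integral>x. z x * u x + t * (z x * v x) \<partial>lborel)"
    by (simp add: algebra_simps)
  also have "\<dots> = (\<integral>x. z x * u x \<partial>lborel) + t * (\<integral>x. z x * v x \<partial>lborel)"
    using H1V_integrable_products(3)[OF assms(3,1)] H1V_integrable_products(3)[OF assms(3,2)] by simp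
  finally show ?thesis unfolding nonlocal_deriv_def 1 by (simp add: algebra_simps)
qed

text \<open>Euler's identity: the nonlocal term is homogeneous of degree
  \<open>q + 2\<close>.\<close>

lemma nonlocal_deriv_self: "nonlocal_deriv q u u = (q + 2) * (L2sq u * powr_integral q u)"
proof -
  have pt: "V x * (q * \<bar>u x\<bar> powr (q - 1) * sgn (u x) * u x) = q * (V x * \<bar>u x\<bar> powr q)" for x
  proof (cases "u x = 0")
    case False
    have "\<bar>u x\<bar> powr (q - 1) * (sgn (u x) * u x) = \<bar>u x\<bar> powr (q - 1) * \<bar>u x\<bar> powr 1"
      using False by (cases "u x > 0") simp_all
    also have "\<dots> = \<bar>u x\<bar> powr q" by (simp only: powr_add[symmetric]) simp
    finally show ?thesis by (simp only: mult.assoc mult.left_commute[of "V x"])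
  qed simp
  have "powr_integral_deriv q u u = q * powr_integral q u" unfolding powr_integral_deriv_def powr_integral_def pt by simp
  then show ?thesis by (simp add: nonlocal_deriv_def L2sq_def power2_eq_square algebra_simps)
qed

text \<open>The coefficients are free because \<open>I\<close> is the case \<open>a = 1/2\<close>,
  \<open>b = 1/q\<close> and \<open>J\<close> the case \<open>a = 1\<close>,
  \<open>b = (q+2)/q\<close>.\<close>

lemma functional_dir_deriv:
  assumes "u \<in> H1V V" "v \<in> H1V V" "q \<ge> 2"
  shows "has_dir_deriv (\<lambda>u. a * normVsq V u - b * L2sq u * powr_integral q u) u v (a * (2 * inner_V u v) - b * nonlocal_deriv q u v)"
proof -
  have N: "((\<lambda>t. normVsq V (\<lambda>x. u x + t * v x)) has_real_derivative 2 * inner_V u v) (at 0)"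
    unfolding normVsq_add_scaled[OF assms(1,2)] by (auto intro!: derivative_eq_intros)
  have L: "((\<lambda>t. L2sq (\<lambda>x. u x + t * v x)) has_real_derivative 2 * (\<integral>x. u x * v x \<partial>lborel)) (at 0)"
    unfolding L2sq_add_scaled[OF assms(1,2)] by (auto intro!: derivative_eq_intros)
  show ?thesis unfolding has_dir_deriv_def
    by (rule DERIV_cong, rule DERIV_diff[OF DERIV_cmult[OF N] DERIV_mult[OF DERIV_cmult[OF L] has_real_derivative_powr_integral(1)[OF assms]]])
       (simp add: nonlocal_deriv_def algebra_simps)
qed

end

section \<open>The Nehari set as a natural constraint\<close>

text \<open>Criticality on the Nehari set is encoded as vanishing of the derivative of
  \<open>I\<close> in every direction annihilated by the derivative of \<open>J\<close>; these are
  the tangent directions at \<open>u\<close>.\<close>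

theorem lemma3p2:
  fixes p C :: real and V :: "R2 \<Rightarrow> real" and V' :: "R2 \<Rightarrow> R2" and u :: "R2 \<Rightarrow> real"
  assumes "p > 1"
    and "\<forall>x. V x > 0"
    and "\<forall>x. (V has_derivative (\<lambda>h. V' x \<bullet> h)) (at x)" and "continuous_on UNIV V'"
    and "filterlim V at_top at_infinity"
    and "C > 0" and "AE x in lborel. norm (V' x) \<le> C * V x powr (3/2)"
    and "u \<in> Nehari V p"
    and "\<forall>v \<in> H1V V. has_dir_deriv (Jfun V p) u v 0 \<longrightarrow> has_dir_deriv (Ifun V p) u v 0"
  shows "\<forall>v \<in> H1V V. has_dir_deriv (Ifun V p) u v 0"
proof
  interpret coercive_potential V V' C
    using assms by unfold_locales auto
  define q where "q = p + 1"
  have q: "q \<ge> 2" "q > 0" using assms(1) by (auto simp: q_def)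
  define I' where "I' v = 1/2 * (2 * inner_V u v) - 1/q * nonlocal_deriv q u v" for v
  define J' where "J' v = 1 * (2 * inner_V u v) - (q+2)/q * nonlocal_deriv q u v" for v
  have u: "u \<in> H1V V" "\<not> (AE x in lborel. u x = 0)" "Jfun V p u = 0"
    using assms(8) by (auto simp: Nehari_def)
  have If: "Ifun V p = (\<lambda>u. 1/2 * normVsq V u - 1/q * L2sq u * powr_integral q u)"
    by (simp add: Ifun_def[abs_def] powr_integral_def q_def)
  have Jf: "Jfun V p = (\<lambda>u. 1 * normVsq V u - (q+2)/q * L2sq u * powr_integral q u)"
    by (simp add: Jfun_def[abs_def] powr_integral_def q_def add.commute[of p 3])
  have I: "has_dir_deriv (Ifun V p) u v (I' v)" and J: "has_dir_deriv (Jfun V p) u v (J' v)" if "v \<in> H1V V" for v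
    unfolding If Jf I'_def J'_def by (rule functional_dir_deriv[OF u(1) that q(1)])+
  define N S where "N = normVsq V u" and "S = L2sq u * powr_integral q u"
  have N: "N > 0" unfolding N_def by (rule normVsq_pos[OF u(1,2)])
  \<comment> \<open>The equation \<open>J(u) = 0\<close>, which eliminates the nonlocal term
    \<open>S\<close> in favour of \<open>N\<close>.\<close>
  have NS: "N = (q+2)/q * S" using u(3) by (simp add: Jf N_def S_def)
  \<comment> \<open>By Euler's identity \<open>I' u\<close> is \<open>N - (q+2)/q * S\<close>, which
    is \<open>J(u)\<close>.\<close>
  have I'u: "I' u = 0"
    using NS q by (simp add: I'_def nonlocal_deriv_self normVsq_eq_inner_V[symmetric] flip: N_def S_def)
  have "J' u = 2 * N - (q + 2) * ((q+2)/q * S)"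
    by (simp add: J'_def nonlocal_deriv_self normVsq_eq_inner_V[symmetric] flip: N_def S_def)
  \<comment> \<open>Replacing \<open>(q+2)/q * S\<close> by \<open>N\<close> leaves
    \<open>2 * N - (q + 2) * N\<close>.\<close>
  then have J'u: "J' u = - q * N" unfolding NS[symmetric] by (simp add: algebra_simps)
  fix v assume v: "v \<in> H1V V"
  \<comment> \<open>Chosen so that \<open>w\<close>, which is \<open>v\<close> minus
    \<open>a\<close> times \<open>u\<close>, is annihilated by \<open>J'\<close>;
    \<open>J' u\<close> is nonzero since \<open>q\<close> and \<open>N\<close> are positive.\<close>
  define a where "a = J' v / J' u"
  define w where "w = (\<lambda>x. v x + (- a) * u x)"
  have w: "w \<in> H1V V" unfolding w_def by (rule H1V_add_scaled[OF v u(1)])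
  have J'w: "J' w = J' v - a * J' u" and I'w: "I' w = I' v - a * I' u"
    unfolding J'_def I'_def w_def inner_V_add_scaled[OF v u(1) u(1)] nonlocal_deriv_add_scaled[OF v u(1) u(1) q(1)]
    by (simp_all add: algebra_simps)
  have "J' w = 0" using J'w J'u N q by (simp add: a_def)
  then have "has_dir_deriv (Ifun V p) u w 0" using J[OF w] assms(9) w by auto
  \<comment> \<open>The hypothesis gives derivative 0 along \<open>w\<close>, and uniqueness of
    derivatives identifies it with \<open>I' w\<close>.\<close>
  then have "I' w = 0" using I[OF w] DERIV_unique unfolding has_dir_deriv_def by blast
  then have "I' v = 0" using I'w I'u by simp
  then show "has_dir_deriv (Ifun V p) u v 0" using I[OF v] by simp
qed

end
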